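(* Let $z,z'\in\mathbb C$. Upon the identification $\mathrm{Sym}_{\mathbb C}=\mathbb C[e_1,e_2,\dots]$, the Laguerre operator $\mathfrak D^{\mathsf L}:\mathrm{Sym}_{\mathbb C}\to\mathrm{Sym}_{\mathbb C}$ with parameters $z$ and $z'$ can be written as the following second order differential operator in the variables $e_1,e_2,\dots$: $$ \begin{aligned} \mathfrak D^{\mathsf L}&=\sum_{n\ge1}\left(\sum_{k=0}^{n-1}(2n-1-2k)e_{2n-1-k}e_k\right)\frac{\partial^2}{\partial e_n^2}\\ &\quad+2\sum_{m>n\ge1}\left(\sum_{k=0}^{n-1}(m+n-1-2k)e_{m+n-1-k}e_k\right)\frac{\partial^2}{\partial e_m\partial e_n}\\ &\quad+\sum_{n=1}^\infty\big(-ne_n+(z-n+1)(z'-n+1)e_{n-1}\big)\frac{\partial}{\partial e_n}, \end{aligned} $$ with the understanding that $e_0=1$.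
   Context: $\mathbb Y$ is the set of all partitions, identified with Young diagrams; $|\nu|$ is the number of boxes of $\nu$. $\mathrm{Sym}$ is the algebra of symmetric functions over $\mathbb R$, $\mathrm{Sym}_{\mathbb C}=\mathrm{Sym}\otimes_{\mathbb R}\mathbb C$; $e_1,e_2,\dots$ are the elementary symmetric functions, which are algebraically independent generators, so $\mathrm{Sym}_{\mathbb C}=\mathbb C[e_1,e_2,\dots]$. $S_\nu$ ($\nu\in\mathbb Y$) are the Schur symmetric functions, which form a basis. For a box $\square=(i,j)$ (row $i$, column $j$) its content is $c(\square)=j-i$. $\nu^-$ denotes the set of corner boxes of $\nu$, i.e. boxes $\square\in\nu$ such that $\nu\setminus\square$ is again a Young diagram. The Laguerre operator with parameters $z,z'$ is the linear operator on $\mathrm{Sym}_{\mathbb C}$ defined by $$\mathfrak D^{\mathsf L}S_\nu=-|\nu|S_\nu+\sum_{\square\in\nu^-}(z+c(\square))(z'+c(\square))S_{\nu\setminus\square},\qquad \nu\in\mathbb Y.$$ *)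

theory Defs
  imports
    "HOL-Library.Poly_Mapping"
    "HOL-Combinatorics.Permutations"
    "Jordan_Normal_Form.Determinant"
begin

text \<open>
  Multivariate polynomials over the complex numbers: a monomial is a finitely supported exponent
  vector and a polynomial is a finitely supported function from monomials to coefficients.
  Variables are numbered from 0.  The type is used for the polynomial rings in
  \<open>x\<^sub>1, \<dots>, x\<^sub>N\<close> (variables \<open>0, \<dots>, N - 1\<close>) and for the polynomial ring in
  \<open>e\<^sub>1, e\<^sub>2, \<dots>\<close> (variable \<open>i\<close> is \<open>e\<^sub>i\<^sub>+\<^sub>1\<close>).
\<close>

abbreviation lookup :: "('a \<Rightarrow>\<^sub>0 'b::zero) \<Rightarrow> 'a \<Rightarrow> 'b" where
  "lookup \<equiv> Poly_Mapping.lookup"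

abbreviation keys :: "('a \<Rightarrow>\<^sub>0 'b::zero) \<Rightarrow> 'a set" where
  "keys \<equiv> Poly_Mapping.keys"

type_synonym cpoly = "(nat \<Rightarrow>\<^sub>0 nat) \<Rightarrow>\<^sub>0 complex"

definition pvar :: "nat \<Rightarrow> cpoly" where
  "pvar i = Poly_Mapping.single (Poly_Mapping.single i 1) 1"

definition pconst :: "complex \<Rightarrow> cpoly" where
  "pconst c = Poly_Mapping.single 0 c"

definition pderiv_var :: "nat \<Rightarrow> cpoly \<Rightarrow> cpoly" where
  "pderiv_var i p = (\<Sum>m\<in>keys p.
     Poly_Mapping.single (m - Poly_Mapping.single i 1) (of_nat (lookup m i) * lookup p m))"

definition mon_deg :: "(nat \<Rightarrow>\<^sub>0 nat) \<Rightarrow> nat" where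
  "mon_deg m = (\<Sum>i\<in>keys m. lookup m i)"


section \<open>The algebra of symmetric functions\<close>

text \<open>
  The graded projective limit of the algebras of symmetric polynomials in \<open>x\<^sub>1, \<dots>, x\<^sub>N\<close>: a
  symmetric function is a sequence of symmetric polynomials \<open>f N\<close> in \<open>N\<close> variables, of uniformly
  bounded degree, such that setting the last variable of \<open>f (N + 1)\<close> to 0 gives \<open>f N\<close>.
  The scalars are the complex numbers, so this is the complexified algebra.
\<close>

definition in_vars :: "nat \<Rightarrow> cpoly \<Rightarrow> bool" where
  "in_vars N p \<longleftrightarrow> (\<forall>m\<in>keys p. keys m \<subseteq> {..<N})"

definition sym_poly :: "nat \<Rightarrow> cpoly \<Rightarrow> bool" where
  "sym_poly N p \<longleftrightarrow> in_vars N p \<and>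
     (\<forall>\<sigma>. \<sigma> permutes {..<N} \<longrightarrow> (\<forall>m. lookup p (Poly_Mapping.map_key \<sigma> m) = lookup p m))"

definition sym_seq :: "(nat \<Rightarrow> cpoly) \<Rightarrow> bool" where
  "sym_seq f \<longleftrightarrow>
     (\<forall>N. sym_poly N (f N)) \<and>
     (\<forall>N m. lookup (f N) m = (lookup (f (Suc N)) m when keys m \<subseteq> {..<N})) \<and>
     (\<exists>d. \<forall>N. \<forall>m\<in>keys (f N). mon_deg m \<le> d)"

lemma keys_add_nat: "keys (a + b) = keys a \<union> keys (b :: nat \<Rightarrow>\<^sub>0 nat)"
  by (auto simp: in_keys_iff lookup_add)

lemma mon_deg_superset: "finite A \<Longrightarrow> keys m \<subseteq> A \<Longrightarrow> mon_deg m = (\<Sum>i\<in>A. lookup m i)"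
  unfolding mon_deg_def by (rule sum.mono_neutral_left) (auto simp: in_keys_iff)

lemma mon_deg_add: "mon_deg (a + b) = mon_deg a + mon_deg b"
  by (simp add: mon_deg_superset[of "keys a \<union> keys b"] keys_add_nat lookup_add sum.distrib)

lemma lookup_times:
  "lookup (p * q) m = Sum_any (\<lambda>(a, b). lookup p a * lookup q b when m = a + b)" for p q :: cpoly
  by (simp add: times_poly_mapping.rep_eq prod_fun_unfold_prod)

lemma bij_map_key:
  assumes "\<sigma> permutes A"
  shows "bij (Poly_Mapping.map_key \<sigma> :: ('a \<Rightarrow>\<^sub>0 nat) \<Rightarrow> _)"
proof (rule o_bij)
  have *: "inj \<sigma>" "inj (Hilbert_Choice.inv \<sigma>)" "\<sigma> \<circ> Hilbert_Choice.inv \<sigma> = id" "Hilbert_Choice.inv \<sigma> \<circ> \<sigma> = id"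
    using assms permutes_inj[OF permutes_inv[OF assms]] by (auto simp: permutes_inj permutes_inv_o)
  show "Poly_Mapping.map_key (Hilbert_Choice.inv \<sigma>) \<circ> Poly_Mapping.map_key \<sigma> = (id :: ('a \<Rightarrow>\<^sub>0 nat) \<Rightarrow> _)"
    using * by (intro ext) (simp add: map_key_compose map_key_id[folded id_def])
  show "Poly_Mapping.map_key \<sigma> \<circ> Poly_Mapping.map_key (Hilbert_Choice.inv \<sigma>) = (id :: ('a \<Rightarrow>\<^sub>0 nat) \<Rightarrow> _)"
    using * by (intro ext) (simp add: map_key_compose map_key_id[folded id_def])
qed

lemma sym_poly_times: assumes "sym_poly N p" "sym_poly N q" shows "sym_poly N (p * q)"
  unfolding sym_poly_def
proof (intro conjI allI impI)
  have "keys m \<subseteq> {..<N}" if "m \<in> keys (p * q)" for m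
  proof -
    obtain a b where "m = a + b" "a \<in> keys p" "b \<in> keys q"
      using keys_mult[of p q] \<open>m \<in> keys (p * q)\<close> by blast
    moreover have "keys a \<subseteq> {..<N}" "keys b \<subseteq> {..<N}"
      using assms calculation unfolding sym_poly_def in_vars_def by blast+
    ultimately show ?thesis by (simp only: keys_add_nat Un_least)
  qed
  then show "in_vars N (p * q)"
    unfolding in_vars_def by blast
next
  fix \<sigma> and m :: "nat \<Rightarrow>\<^sub>0 nat" assume \<sigma>: "\<sigma> permutes {..<N}"
  let ?h = "Poly_Mapping.map_key \<sigma> :: (nat \<Rightarrow>\<^sub>0 nat) \<Rightarrow> _"
  have inj: "inj \<sigma>" using \<sigma> by (rule permutes_inj)
  have bij: "bij ?h" using \<sigma> by (rule bij_map_key)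
  have p: "lookup p (?h a) = lookup p a" and q: "lookup q (?h a) = lookup q a" for a
    using assms \<sigma> unfolding sym_poly_def by blast+
  have bij2: "bij (map_prod ?h ?h)"
    using bij by (simp add: bij_def prod.inj_map map_prod_surj)
  have eq: "?h m = ?h a + ?h b \<longleftrightarrow> m = a + b" for a b
    using bij inj by (simp flip: map_key_plus add: inj_eq bij_is_inj)
  have "lookup (p * q) (?h m) =
      Sum_any (\<lambda>(a, b). lookup p a * lookup q b when ?h m = a + b)"
    by (rule lookup_times)
  also have "\<dots> = Sum_any (\<lambda>(a, b). lookup p a * lookup q b when m = a + b)"
    by (rule Sum_any.reindex_cong[OF bij2])
      (auto simp: fun_eq_iff p q eq)
  finally show "lookup (p * q) (?h m) = lookup (p * q) m"
    by (simp add: lookup_times)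
qed

lemma sym_seq_const: "sym_seq (\<lambda>_. pconst c)"
proof -
  have inj: "\<sigma> permutes {..<N} \<Longrightarrow> inj \<sigma>" for \<sigma> :: "nat \<Rightarrow> nat" and N
    by (rule permutes_inj)
  have z: "Poly_Mapping.map_key \<sigma> m = 0 \<longleftrightarrow> m = 0"
    if "\<sigma> permutes {..<N}" for \<sigma> N and m :: "nat \<Rightarrow>\<^sub>0 nat"
    using inj_eq[OF bij_is_inj[OF bij_map_key[OF that]], of m 0] inj[OF that] by simp
  have "sym_poly N (pconst c)" for N
    using z by (auto simp: sym_poly_def in_vars_def pconst_def lookup_single when_def)
  then show ?thesis
    unfolding sym_seq_def
    by (auto simp: pconst_def lookup_single when_def mon_deg_def)
qed

lemma sym_seq_add: assumes "sym_seq f" "sym_seq g" shows "sym_seq (\<lambda>N. f N + g N)"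
proof -
  obtain d d' where d: "\<And>N m. m \<in> keys (f N) \<Longrightarrow> mon_deg m \<le> d"
      "\<And>N m. m \<in> keys (g N) \<Longrightarrow> mon_deg m \<le> d'"
    using assms unfolding sym_seq_def by metis
  have "mon_deg m \<le> max d d'" if "m \<in> keys (f N + g N)" for N m
    using keys_add[of "f N" "g N"] that d by fastforce
  moreover have "sym_poly N (f N + g N)" for N
  proof -
    have "sym_poly N (f N)" "sym_poly N (g N)"
      using assms unfolding sym_seq_def by blast+
    then show ?thesis
      using keys_add[of "f N" "g N"] unfolding sym_poly_def in_vars_def
      by (simp add: lookup_add) blast
  qed
  moreover have "lookup (f N + g N) m =
      (lookup (f (Suc N) + g (Suc N)) m when keys m \<subseteq> {..<N})" for N m
  proof -
    have "lookup (f N) m =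
          (lookup (f (Suc N)) m when keys m \<subseteq> {..<N})"
        "lookup (g N) m =
          (lookup (g (Suc N)) m when keys m \<subseteq> {..<N})"
      using assms unfolding sym_seq_def by blast+
    then show ?thesis by (simp only: lookup_add when_add_distrib)
  qed
  ultimately show ?thesis unfolding sym_seq_def by blast
qed

lemma sym_seq_times: assumes "sym_seq f" "sym_seq g" shows "sym_seq (\<lambda>N. f N * g N)"
proof -
  obtain d d' where d: "\<And>N m. m \<in> keys (f N) \<Longrightarrow> mon_deg m \<le> d"
      "\<And>N m. m \<in> keys (g N) \<Longrightarrow> mon_deg m \<le> d'"
    using assms unfolding sym_seq_def by metis
  have "mon_deg m \<le> d + d'" if mk: "m \<in> keys (f N * g N)" for N m
  proof -
    obtain a b where "m = a + b" "a \<in> keys (f N)" "b \<in> keys (g N)"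
      using keys_mult[of "f N" "g N"] mk by blast
    then show ?thesis by (simp add: mon_deg_add add_mono d)
  qed
  moreover have "sym_poly N (f N * g N)" for N
    using assms by (auto simp: sym_seq_def intro: sym_poly_times)
  moreover have "lookup (f N * g N) m =
      (lookup (f (Suc N) * g (Suc N)) m when keys m \<subseteq> {..<N})" for N m
  proof -
    have tr: "lookup (f N) a = (lookup (f (Suc N)) a when keys a \<subseteq> {..<N})"
        "lookup (g N) a = (lookup (g (Suc N)) a when keys a \<subseteq> {..<N})" for a
      using assms unfolding sym_seq_def by blast+
    have *: "(\<lambda>(a, b). lookup (f N) a * lookup (g N) b when m = a + b) =
      (\<lambda>(a, b). if keys m \<subseteq> {..<N}
         then (lookup (f (Suc N)) a * lookup (g (Suc N)) b when m = a + b) else 0)"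
      by (auto simp: fun_eq_iff tr when_def keys_add_nat)
    show ?thesis
      unfolding lookup_times * by (cases "keys m \<subseteq> {..<N}") simp_all
  qed
  ultimately show ?thesis unfolding sym_seq_def by blast
qed

lemma pconst_0 [simp]: "pconst 0 = 0" and pconst_1 [simp]: "pconst 1 = 1"
  by (simp_all add: pconst_def)

typedef symfun = "{f. sym_seq f}"
  morphisms in_N_vars Abs_symfun
  using sym_seq_const by blast

setup_lifting type_definition_symfun

instantiation symfun :: comm_ring_1
begin

lift_definition zero_symfun :: symfun is "\<lambda>_. 0"
  using sym_seq_const[of 0] by simp

lift_definition one_symfun :: symfun is "\<lambda>_. 1"
  using sym_seq_const[of 1] by simp

lift_definition plus_symfun :: "symfun \<Rightarrow> symfun \<Rightarrow> symfun" is "\<lambda>f g N. f N + g N"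
  by (rule sym_seq_add)

lift_definition times_symfun :: "symfun \<Rightarrow> symfun \<Rightarrow> symfun" is "\<lambda>f g N. f N * g N"
  by (rule sym_seq_times)

lift_definition uminus_symfun :: "symfun \<Rightarrow> symfun" is "\<lambda>f N. - f N"
  using sym_seq_times[OF sym_seq_const[of "- 1"]] by (simp add: pconst_def single_uminus)

definition minus_symfun :: "symfun \<Rightarrow> symfun \<Rightarrow> symfun" where
  "minus_symfun f g = f + - g"

instance
proof
  show "(0 :: symfun) \<noteq> 1"
    by transfer (simp add: fun_eq_iff)
qed (unfold minus_symfun_def, (transfer; simp add: algebra_simps)+)

end

lift_definition sym_const :: "complex \<Rightarrow> symfun" is "\<lambda>c _. pconst c"
  by (rule sym_seq_const)

definition sym_scale :: "complex \<Rightarrow> symfun \<Rightarrow> symfun" where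
  "sym_scale c f = sym_const c * f"


section \<open>Elementary symmetric functions and the polynomial ring they generate\<close>

lemma lookup_elem:
  "lookup (\<Sum>I | I \<subseteq> {..<N} \<and> card I = n. \<Prod>i\<in>I. pvar i) m =
   (if keys m \<subseteq> {..<N} \<and> card (keys m) = n \<and> (\<forall>i\<in>keys m. lookup m i = 1) then 1 else 0)"
proof -
  let ?u = "\<lambda>I. (\<Sum>i\<in>I. Poly_Mapping.single i (1::nat))"
  have pr: "(\<Prod>i\<in>I. pvar i) = Poly_Mapping.single (?u I) 1" if "finite I" for I :: "nat set"
    using that by induction (simp_all add: pvar_def mult_single)
  have lk: "lookup (?u I) j = (if j \<in> I then 1 else 0)" if "finite I" for I :: "nat set" and j
    using that by (simp add: lookup_sum lookup_single when_def)
  have ks: "keys (?u I) = I" if "finite I" for I :: "nat set"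
    using lk[OF that] by (auto simp: in_keys_iff split: if_splits)
  have u: "?u I = m \<longleftrightarrow> I = keys m \<and> (\<forall>i\<in>keys m. lookup m i = 1)" if "finite I" for I :: "nat set"
  proof
    assume "?u I = m"
    then show "I = keys m \<and> (\<forall>i\<in>keys m. lookup m i = 1)"
      using lk[OF that] ks[OF that] by metis
  next
    assume "I = keys m \<and> (\<forall>i\<in>keys m. lookup m i = 1)"
    then show "?u I = m"
      by (intro poly_mapping_eqI) (use lk[OF that] in \<open>auto simp: in_keys_iff\<close>)
  qed
  have fin: "finite I" if "I \<subseteq> {..<N}" for I :: "nat set"
    using that finite_subset by blast
  have "lookup (\<Sum>I | I \<subseteq> {..<N} \<and> card I = n. \<Prod>i\<in>I. pvar i) m =
      (\<Sum>I | I \<subseteq> {..<N} \<and> card I = n.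
         if I = keys m then (if \<forall>i\<in>keys m. lookup m i = 1 then 1 else 0) else 0)"
    unfolding lookup_sum
  proof (intro sum.cong refl)
    fix I assume "I \<in> {I. I \<subseteq> {..<N} \<and> card I = n}"
    then have I: "finite I" using fin by blast
    show "lookup (\<Prod>i\<in>I. pvar i) m = (if I = keys m
        then (if \<forall>i\<in>keys m. lookup m i = 1 then 1 else 0) else 0)"
      unfolding pr[OF I] lookup_single when_def u[OF I] by (cases "I = keys m") simp_all
  qed
  also have "\<dots> = (if keys m \<subseteq> {..<N} \<and> card (keys m) = n \<and>
      (\<forall>i\<in>keys m. lookup m i = 1) then 1 else 0)"
    by (subst sum.delta) auto
  finally show ?thesis .
qed

lift_definition elem_sym :: "nat \<Rightarrow> symfun" is
  "\<lambda>n N. \<Sum>I | I \<subseteq> {..<N} \<and> card I = n. \<Prod>i\<in>I. pvar i"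
proof -
  fix n
  let ?e = "\<lambda>N. \<Sum>I | I \<subseteq> {..<N} \<and> card I = n. \<Prod>i\<in>I. pvar i"
  have "sym_poly N (?e N)" for N
    unfolding sym_poly_def
  proof (intro conjI allI impI)
    show "in_vars N (?e N)"
      by (auto simp: in_vars_def in_keys_iff[of _ "?e N"] lookup_elem split: if_splits)
  next
    fix \<sigma> and m :: "nat \<Rightarrow>\<^sub>0 nat" assume \<sigma>: "\<sigma> permutes {..<N}"
    have inj: "inj \<sigma>" and surj: "surj \<sigma>"
      using \<sigma> by (auto simp: permutes_inj permutes_surj)
    have k: "keys (Poly_Mapping.map_key \<sigma> m) = \<sigma> -` keys m"
      using inj by (rule keys_map_key)
    have l: "lookup (Poly_Mapping.map_key \<sigma> m) i = lookup m (\<sigma> i)" for i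
      using inj by (simp add: map_key.rep_eq)
    have "card (\<sigma> -` keys m) = card (keys m)"
      using inj surj by (intro card_vimage_inj) auto
    moreover have "\<sigma> -` keys m \<subseteq> {..<N} \<longleftrightarrow> keys m \<subseteq> {..<N}"
    proof -
      have a: "i < N \<longleftrightarrow> \<sigma> i < N" for i using permutes_in_image[OF \<sigma>, of i] by simp
      show ?thesis
      proof
        assume L: "\<sigma> -` keys m \<subseteq> {..<N}"
        show "keys m \<subseteq> {..<N}"
        proof
          fix j assume j: "j \<in> keys m"
          obtain i where i: "j = \<sigma> i" using surj by (rule surjE)
          have "i < N" using j L i by auto
          then show "j \<in> {..<N}" using a[of i] i by simp
        qed
      next
        assume "keys m \<subseteq> {..<N}"
        then show "\<sigma> -` keys m \<subseteq> {..<N}"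
          using a by auto
      qed
    qed
    moreover have "(\<forall>i\<in>\<sigma> -` keys m. lookup m (\<sigma> i) = 1) \<longleftrightarrow> (\<forall>i\<in>keys m. lookup m i = 1)"
      using surj by (metis surjD vimageE vimageI)
    ultimately show "lookup (?e N) (Poly_Mapping.map_key \<sigma> m) = lookup (?e N) m"
      by (simp add: lookup_elem k l)
  qed
  moreover have "mon_deg m \<le> n" if "m \<in> keys (?e N)" for N m
  proof -
    have "lookup (?e N) m \<noteq> 0" using that unfolding in_keys_iff .
    then have "card (keys m) = n" "\<forall>i\<in>keys m. lookup m i = 1"
      unfolding lookup_elem by presburger+
    then show ?thesis by (simp add: mon_deg_def)
  qed
  moreover have "lookup (?e N) m = (lookup (?e (Suc N)) m when keys m \<subseteq> {..<N})" for N m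
  proof -
    have "keys m \<subseteq> {..<N} \<Longrightarrow> keys m \<subseteq> {..<Suc N}" by auto
    then show ?thesis unfolding lookup_elem when_def by auto
  qed
  ultimately show "sym_seq ?e"
    unfolding sym_seq_def by blast
qed

text \<open>
  Elements of \<open>\<complex>[e\<^sub>1, e\<^sub>2, \<dots>]\<close>: the generators \<open>evar n\<close> (with \<open>e\<^sub>0 = 1\<close>), the
  partial derivatives with respect to them (for \<open>n \<ge> 1\<close>), and the canonical algebra homomorphism
  \<open>of_epoly\<close> to the symmetric functions, which sends \<open>e\<^sub>n\<close> to the \<open>n\<close>-th elementary symmetric
  function and identifies the two algebras.
\<close>

definition evar :: "nat \<Rightarrow> cpoly" where
  "evar n = (if n = 0 then 1 else pvar (n - 1))"

definition ederiv :: "nat \<Rightarrow> cpoly \<Rightarrow> cpoly" where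
  "ederiv n p = pderiv_var (n - 1) p"

definition of_epoly :: "cpoly \<Rightarrow> symfun" where
  "of_epoly p = (\<Sum>m\<in>keys p. sym_scale (lookup p m) (\<Prod>i\<in>keys m. elem_sym (Suc i) ^ lookup m i))"


section \<open>Young diagrams and Schur functions\<close>

text \<open>
  Partitions are represented by their Young diagrams.  Rows and columns are numbered from 0, which
  does not affect contents.
\<close>

definition young_diagram :: "(nat \<times> nat) set \<Rightarrow> bool" where
  "young_diagram \<nu> \<longleftrightarrow> finite \<nu> \<and>
     (\<forall>i j i' j'. (i, j) \<in> \<nu> \<longrightarrow> i' \<le> i \<longrightarrow> j' \<le> j \<longrightarrow> (i', j') \<in> \<nu>)"

definition content :: "nat \<times> nat \<Rightarrow> int" where
  "content b = int (snd b) - int (fst b)"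

definition corners :: "(nat \<times> nat) set \<Rightarrow> (nat \<times> nat) set" where
  "corners \<nu> = {b \<in> \<nu>. young_diagram (\<nu> - {b})}"

definition part :: "(nat \<times> nat) set \<Rightarrow> nat \<Rightarrow> nat" where
  "part \<nu> i = card {j. (i, j) \<in> \<nu>}"

definition num_parts :: "(nat \<times> nat) set \<Rightarrow> nat" where
  "num_parts \<nu> = card (fst ` \<nu>)"

text \<open>
  The alternant \<open>det (x\<^sub>i ^ (\<nu>\<^sub>j + N - j))\<close> with \<open>i, j = 1, \<dots>, N\<close>.  For the empty diagram it is
  the Vandermonde determinant.
\<close>

definition alternant :: "nat \<Rightarrow> (nat \<times> nat) set \<Rightarrow> cpoly" where
  "alternant N \<nu> = det (mat N N (\<lambda>(i, j). pvar i ^ (part \<nu> j + (N - 1 - j))))"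

text \<open>
  The Schur function is the symmetric function whose specialization to \<open>N\<close> variables, for every
  \<open>N\<close> not less than the number of parts, is the ratio of the alternant and the Vandermonde
  determinant.
\<close>

definition schur :: "(nat \<times> nat) set \<Rightarrow> symfun" where
  "schur \<nu> = (THE s. \<forall>N \<ge> num_parts \<nu>. in_N_vars s N * alternant N {} = alternant N \<nu>)"


section \<open>The Laguerre operator\<close>

definition laguerre_op :: "complex \<Rightarrow> complex \<Rightarrow> symfun \<Rightarrow> symfun" where
  "laguerre_op z z' = (THE D. Vector_Spaces.linear sym_scale sym_scale D \<and>
     (\<forall>\<nu>. young_diagram \<nu> \<longrightarrow>
        D (schur \<nu>) = sym_scale (- of_nat (card \<nu>)) (schur \<nu>)
          + (\<Sum>b\<in>corners \<nu>. sym_scale ((z + of_int (content b)) * (z' + of_int (content b)))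
                              (schur (\<nu> - {b})))))"

end

theory Submission
  imports Defs "HOL-Computational_Algebra.Formal_Power_Series"
begin

text \<open>
  In finitely many variables the theorem is a computation with an honest differential operator.  Let
  \<open>V\<close> be the Vandermonde determinant in \<open>x\<^sub>1, \<dots>, x\<^sub>N\<close>, let \<open>z = N\<close> and \<open>z' = N + b\<close>, and put
  \<open>L = \<Sum>\<^sub>i x\<^sub>i \<partial>\<^sub>i\<^sup>2 + (b + 1 - x\<^sub>i) \<partial>\<^sub>i\<close>.

  On the one hand \<open>L\<close> sends the alternant with exponents \<open>l\<^sub>j = \<nu>\<^sub>j + N - j\<close> to the sum of
  \<open>l\<^sub>j (l\<^sub>j + b)\<close> times the alternants with \<open>l\<^sub>j\<close> lowered by one, minus \<open>\<Sum> l\<^sub>j\<close> times itself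
  (\<open>lag_alt\<close>).  Lowering an exponent gives 0 unless it removes a corner box, and
  \<open>l\<^sub>j = z + c\<close>, \<open>l\<^sub>j + b = z' + c\<close> for the content \<open>c\<close> of that box.  Hence, up to the additive
  constant \<open>N (N - 1) / 2\<close>, the Laguerre operator is \<open>V\<^sup>-\<^sup>1 L V\<close> on symmetric polynomials
  (\<open>laguerre_op_N_vars\<close>).

  On the other hand \<open>V\<^sup>-\<^sup>1 L V\<close> can be computed by the chain rule on polynomials in
  \<open>e\<^sub>1, \<dots>, e\<^sub>N\<close> (\<open>lag_vdm_times_at_esp\<close>).  Its second order coefficients are
  \<open>\<Sum>\<^sub>i x\<^sub>i (\<partial>\<^sub>i e\<^sub>m) (\<partial>\<^sub>i e\<^sub>n)\<close>, evaluated by a recursion in \<open>(m, n)\<close> (\<open>sum_var_esp_esp\<close>).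
  The first order coefficients are determined by the values on the \<open>e\<^sub>n\<close> themselves, and these
  are known because \<open>e\<^sub>n V\<close> is an alternant (\<open>esp_times_vdm\<close>).

  So the two sides agree in \<open>N\<close> variables when \<open>z = N\<close>, for all large \<open>N\<close> and all \<open>z'\<close>.  For
  fixed \<open>z'\<close> their difference has the form \<open>X + z Y\<close> with symmetric functions \<open>X\<close> and
  \<open>Y\<close>, and setting variables to 0 shows that in any number \<open>M\<close> of variables it vanishes for
  infinitely many \<open>z\<close>, so \<open>X = Y = 0\<close> (\<open>affine_eq_0I\<close>).

  The operator is given by its values on Schur functions, so these must be shown to exist and to form
  a basis.  Existence is the Jacobi--Trudi formula, which produces determinants of complete symmetric
  functions independent of \<open>N\<close> (\<open>in_N_vars_jt_det\<close>, \<open>jt_det_Suc\<close>).  Independence and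
  spanning are read off from the coefficients of \<open>V f\<close> at strictly decreasing exponents, which
  determine an antisymmetric polynomial (\<open>schur_expansion\<close>).
\<close>

section \<open>Partial derivatives and monomials\<close>

lemma poly_mapping_as_sum_single:
  assumes "finite A" "keys p \<subseteq> A"
  shows "p = (\<Sum>m\<in>A. Poly_Mapping.single m (lookup p m))"
proof (rule poly_mapping_eqI)
  fix k
  show "lookup p k = lookup (\<Sum>m\<in>A. Poly_Mapping.single m (lookup p m)) k"
    using assms by (auto simp: lookup_sum lookup_single when_def in_keys_iff)
qed

lemma cpoly_induct [case_names single add]:
  fixes p :: cpoly
  assumes "\<And>m c. P (Poly_Mapping.single m c)"
    and "\<And>p q. P p \<Longrightarrow> P q \<Longrightarrow> P (p + q)"
  shows "P p"
proof -
  have "P (\<Sum>m\<in>A. Poly_Mapping.single m (lookup p m))" if "finite A" for A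
    using that
  proof induction
    case empty
    show ?case using assms(1)[of 0 0] by simp
  next
    case (insert m A)
    then show ?case by (simp add: assms)
  qed
  from this[of "keys p"] show ?thesis
    using poly_mapping_as_sum_single[of "keys p" p] by simp
qed

lemma lookup_pderiv_var:
  "lookup (pderiv_var i p) m = of_nat (Suc (lookup m i)) * lookup p (m + Poly_Mapping.single i 1)"
proof -
  let ?e = "Poly_Mapping.single i (1::nat)"
  have "lookup (pderiv_var i p) m =
      (\<Sum>k\<in>keys p. (of_nat (lookup k i) * lookup p k when k - ?e = m))"
    by (simp add: pderiv_var_def lookup_sum lookup_single)
  also have "\<dots> = (\<Sum>k\<in>keys p. (of_nat (lookup k i) * lookup p k when k = m + ?e))"
  proof (intro sum.cong refl)
    fix k :: "nat \<Rightarrow>\<^sub>0 nat"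
    have "k = (k - ?e) + ?e" if "lookup k i \<noteq> 0"
      by (rule poly_mapping_eqI)
        (use that in \<open>auto simp: lookup_add lookup_minus lookup_single when_def\<close>)
    then show "(of_nat (lookup k i) * lookup p k when k - ?e = m)
        = (of_nat (lookup k i) * lookup p k when k = m + ?e)"
      by (cases "lookup k i = 0") (auto simp: when_def)
  qed
  also have "\<dots> = of_nat (Suc (lookup m i)) * lookup p (m + ?e)"
    by (cases "m + ?e \<in> keys p") (auto simp: when_def lookup_add lookup_single in_keys_iff)
  finally show ?thesis .
qed

lemma pderiv_var_add: "pderiv_var i (p + q) = pderiv_var i p + pderiv_var i q"
  by (rule poly_mapping_eqI) (simp add: lookup_pderiv_var lookup_add algebra_simps)

lemma pderiv_var_0 [simp]: "pderiv_var i 0 = 0"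
  by (rule poly_mapping_eqI) (simp add: lookup_pderiv_var)

lemma pderiv_var_sum: "pderiv_var i (\<Sum>x\<in>A. f x) = (\<Sum>x\<in>A. pderiv_var i (f x))"
  by (induction A rule: infinite_finite_induct) (auto simp: pderiv_var_add)

lemma pderiv_var_single:
  "pderiv_var i (Poly_Mapping.single m c) =
     Poly_Mapping.single (m - Poly_Mapping.single i 1) (of_nat (lookup m i) * c)"
  by (cases "c = 0") (auto simp: pderiv_var_def)

lemma pderiv_var_commute: "pderiv_var i (pderiv_var j p) = pderiv_var j (pderiv_var i p)"
  by (rule poly_mapping_eqI)
    (auto simp: lookup_pderiv_var lookup_add lookup_single when_def add_ac)

lemma pderiv_var_mult:
  "pderiv_var i (p * q) = pderiv_var i p * q + p * pderiv_var i q"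
proof (induction p rule: cpoly_induct)
  case (single a c)
  show ?case
  proof (induction q rule: cpoly_induct)
    case (single b d)
    let ?e = "Poly_Mapping.single i (1::nat)"
    have shift: "x - ?e + y = x + y - ?e" if "lookup x i \<noteq> 0" for x y :: "nat \<Rightarrow>\<^sub>0 nat"
      by (rule poly_mapping_eqI)
        (use that in \<open>auto simp: lookup_add lookup_minus lookup_single when_def\<close>)
    have left: "pderiv_var i (Poly_Mapping.single x u) * Poly_Mapping.single y v =
        Poly_Mapping.single (x + y - ?e) (of_nat (lookup x i) * (u * v))" for x y u v
      using shift[of x y]
      by (cases "lookup x i = 0") (simp_all add: pderiv_var_single mult_single mult.assoc)
    have "pderiv_var i (Poly_Mapping.single a c * Poly_Mapping.single b d) =
        Poly_Mapping.single (a + b - ?e) (of_nat (lookup a i) * (c * d))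
        + Poly_Mapping.single (b + a - ?e) (of_nat (lookup b i) * (d * c))"
      unfolding add.commute[of b a] mult.commute[of d c] single_add[symmetric]
      by (simp add: mult_single pderiv_var_single lookup_add distrib_right)
    then show ?case
      unfolding left[symmetric] by (simp only: mult.commute[of "Poly_Mapping.single a c"])
  next
    case (add p q)
    then show ?case by (simp add: pderiv_var_add algebra_simps)
  qed
next
  case (add p q)
  then show ?case by (simp add: pderiv_var_add algebra_simps)
qed

lemma pderiv_var_pconst [simp]: "pderiv_var i (pconst c) = 0"
  by (simp add: pconst_def pderiv_var_single)

lemma pderiv_var_1 [simp]: "pderiv_var i 1 = 0"
  using pderiv_var_pconst[of i 1] by simp

lemma pderiv_var_pvar: "pderiv_var i (pvar j) = (if i = j then 1 else 0)"
  by (auto simp: pvar_def pderiv_var_single lookup_single)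

lemma pderiv_var_eventually_0:
  "\<exists>K. \<forall>i\<ge>K. pderiv_var i p = 0"
proof -
  have "finite (\<Union>m\<in>keys p. keys m)" by simp
  then obtain K where K: "\<And>i. i \<in> (\<Union>m\<in>keys p. keys m) \<Longrightarrow> i < K"
    by (metis finite_nat_set_iff_bounded)
  have "pderiv_var i p = 0" if "i \<ge> K" for i
  proof -
    have "lookup m i = 0" if "m \<in> keys p" for m
      using K[of i] \<open>i \<ge> K\<close> that by (force simp: in_keys_iff)
    then show ?thesis by (simp add: pderiv_var_def)
  qed
  then show ?thesis by blast
qed

lemma pconst_add: "pconst (a + b) = pconst a + pconst b"
  by (simp add: pconst_def single_add)

lemma pconst_mult: "pconst (a * b) = pconst a * pconst b"
  by (simp add: pconst_def mult_single)

lemma pconst_uminus: "pconst (- a) = - pconst a"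
  by (simp add: pconst_def single_uminus)

lemma pconst_of_nat [simp]: "pconst (of_nat n) = of_nat n"
  by (simp add: pconst_def)

lemma lookup_pconst_times: "lookup (pconst c * p) m = c * lookup p m"
proof (induction p rule: cpoly_induct)
  case (single k d)
  then show ?case by (simp add: pconst_def mult_single lookup_single mult_when)
next
  case (add p q)
  then show ?case by (simp add: algebra_simps lookup_add)
qed

lemma prod_pvar_power:
  "finite A \<Longrightarrow> (\<Prod>i\<in>A. pvar i ^ l i) = Poly_Mapping.single (\<Sum>i\<in>A. Poly_Mapping.single i (l i)) 1"
proof (induction A rule: finite_induct)
  case (insert a A)
  have "pvar a ^ n = Poly_Mapping.single (Poly_Mapping.single a n) 1" for n
    by (induction n) (simp_all add: pvar_def mult_single flip: single_add)
  with insert show ?case by (simp add: mult_single)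
qed simp

lemma lookup_sum_single:
  "finite A \<Longrightarrow> lookup (\<Sum>i\<in>A. Poly_Mapping.single i (l i)) j = (if j \<in> A then l j else 0)"
  by (simp add: lookup_sum lookup_single when_def)

section \<open>Homomorphisms to and from the algebra of symmetric functions\<close>

lemma comm_ring_hom_in_N_vars: "comm_ring_hom (\<lambda>f. in_N_vars f N)"
proof
  show "in_N_vars 0 N = 0" by (simp only: zero_symfun.rep_eq)
  show "in_N_vars 1 N = 1" by (simp only: one_symfun.rep_eq)
  show "in_N_vars (f + g) N = in_N_vars f N + in_N_vars g N" for f g
    by (simp only: plus_symfun.rep_eq)
  show "in_N_vars (f * g) N = in_N_vars f N * in_N_vars g N" for f g
    by (simp only: times_symfun.rep_eq)
qed

lemma in_N_vars_add: "in_N_vars (f + g) N = in_N_vars f N + in_N_vars g N"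
  and in_N_vars_mult: "in_N_vars (f * g) N = in_N_vars f N * in_N_vars g N"
  and in_N_vars_0 [simp]: "in_N_vars 0 N = 0"
  and in_N_vars_1 [simp]: "in_N_vars 1 N = 1"
  and in_N_vars_uminus: "in_N_vars (- f) N = - in_N_vars f N"
  by (simp_all add: plus_symfun.rep_eq times_symfun.rep_eq zero_symfun.rep_eq one_symfun.rep_eq
      uminus_symfun.rep_eq)

lemma in_N_vars_sum: "in_N_vars (\<Sum>x\<in>A. f x) N = (\<Sum>x\<in>A. in_N_vars (f x) N)"
  by (induction A rule: infinite_finite_induct) (simp_all add: in_N_vars_add)

lemma in_N_vars_minus: "in_N_vars (f - g) N = in_N_vars f N - in_N_vars g N"
  unfolding minus_symfun_def in_N_vars_add in_N_vars_uminus by simp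

lemma in_N_vars_sym_scale: "in_N_vars (sym_scale c f) N = pconst c * in_N_vars f N"
  by (simp add: sym_scale_def times_symfun.rep_eq sym_const.rep_eq)

lemma symfun_eqI: "(\<And>N. in_N_vars f N = in_N_vars g N) \<Longrightarrow> f = g"
  using in_N_vars_inject by blast

text \<open>Compatibility with setting the last variable to 0.\<close>

lemma in_N_vars_eq_downward:
  assumes "in_N_vars f N = in_N_vars g N" "M \<le> N"
  shows "in_N_vars f M = in_N_vars g M"
  using assms(2)
proof (induction rule: inc_induct)
  case base
  show ?case by fact
next
  case (step n)
  have "lookup (in_N_vars f n) m = (lookup (in_N_vars f (Suc n)) m when keys m \<subseteq> {..<n})"
    "lookup (in_N_vars g n) m = (lookup (in_N_vars g (Suc n)) m when keys m \<subseteq> {..<n})" for m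
    using in_N_vars[of f] in_N_vars[of g] unfolding sym_seq_def by blast+
  with step show ?case by (intro poly_mapping_eqI) simp
qed

lemma in_N_vars_0_downward:
  assumes "in_N_vars f N = 0" "M \<le> N"
  shows "in_N_vars f M = 0"
  using in_N_vars_eq_downward[of f N 0 M] assms by (simp add: zero_symfun.rep_eq)

lemma symfun_eq_eventuallyI:
  assumes "\<And>N. N \<ge> N0 \<Longrightarrow> in_N_vars f N = in_N_vars g N"
  shows "f = g"
  by (rule symfun_eqI) (metis assms in_N_vars_eq_downward nat_le_linear)

interpretation sym: vector_space sym_scale
proof
  fix a b :: complex and f g :: symfun
  show "sym_scale a (f + g) = sym_scale a f + sym_scale a g"
    by (rule symfun_eqI) (simp add: in_N_vars_sym_scale plus_symfun.rep_eq algebra_simps)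
  show "sym_scale (a + b) f = sym_scale a f + sym_scale b f"
    by (rule symfun_eqI)
      (simp add: in_N_vars_sym_scale plus_symfun.rep_eq pconst_add algebra_simps)
  show "sym_scale a (sym_scale b f) = sym_scale (a * b) f"
    by (rule symfun_eqI) (simp add: in_N_vars_sym_scale pconst_mult)
  show "sym_scale 1 f = f"
    by (rule symfun_eqI) (simp add: in_N_vars_sym_scale)
qed

interpretation symp: vector_space_pair sym_scale sym_scale ..

lemma of_epoly_superset:
  assumes "finite A" "keys p \<subseteq> A"
  shows "of_epoly p =
    (\<Sum>m\<in>A. sym_scale (lookup p m) (\<Prod>i\<in>keys m. elem_sym (Suc i) ^ lookup m i))"
  unfolding of_epoly_def
  by (rule sum.mono_neutral_left) (use assms in \<open>auto simp: in_keys_iff\<close>)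

lemma of_epoly_add: "of_epoly (p + q) = of_epoly p + of_epoly q"
proof -
  have "keys (p + q) \<subseteq> keys p \<union> keys q" by (rule keys_add)
  then show ?thesis
    by (simp add: of_epoly_superset[of "keys p \<union> keys q"] lookup_add
        sym.scale_left_distrib sum.distrib)
qed

lemma of_epoly_single:
  "of_epoly (Poly_Mapping.single m c) = sym_scale c (\<Prod>i\<in>keys m. elem_sym (Suc i) ^ lookup m i)"
  by (cases "c = 0") (auto simp: of_epoly_def)

lemma of_epoly_mult: "of_epoly (p * q) = of_epoly p * of_epoly q"
proof (induction p rule: cpoly_induct)
  case (single a c)
  show ?case
  proof (induction q rule: cpoly_induct)
    case (single b d)
    have sup: "(\<Prod>i\<in>keys m. elem_sym (Suc i) ^ lookup m i) =
        (\<Prod>i\<in>keys a \<union> keys b. elem_sym (Suc i) ^ lookup m i)" if "keys m \<subseteq> keys a \<union> keys b" for m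
      by (rule prod.mono_neutral_left) (use that in \<open>auto simp: in_keys_iff\<close>)
    show ?case
      using sup[of a] sup[of b] sup[of "a + b"]
      by (intro symfun_eqI)
        (simp add: mult_single of_epoly_single keys_add_nat lookup_add power_add prod.distrib
          in_N_vars_sym_scale times_symfun.rep_eq pconst_mult algebra_simps)
  next
    case (add p q)
    then show ?case by (simp add: of_epoly_add algebra_simps)
  qed
next
  case (add p q)
  then show ?case by (simp add: of_epoly_add algebra_simps)
qed

lemma of_epoly_pconst: "of_epoly (pconst c) = sym_scale c 1"
  by (simp add: pconst_def of_epoly_single)

lemma of_epoly_0 [simp]: "of_epoly 0 = 0"
  by (simp add: of_epoly_def)

lemma of_epoly_1 [simp]: "of_epoly 1 = 1"
  using of_epoly_pconst[of 1] by simp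

lemma of_epoly_sum: "of_epoly (\<Sum>x\<in>A. f x) = (\<Sum>x\<in>A. of_epoly (f x))"
  by (induction A rule: infinite_finite_induct) (simp_all add: of_epoly_add)

lemma of_epoly_evar: "of_epoly (evar n) = elem_sym n"
proof (cases n)
  case 0
  have "elem_sym 0 = 1"
  proof (rule symfun_eqI)
    fix N :: nat
    have "{I. I \<subseteq> {..<N} \<and> card I = 0} = {{}}"
      using finite_subset[of _ "{..<N}"] by auto
    then show "in_N_vars (elem_sym 0) N = in_N_vars 1 N"
      by (simp add: elem_sym.rep_eq one_symfun.rep_eq)
  qed
  then show ?thesis using 0 by (simp add: evar_def)
next
  case (Suc k)
  then show ?thesis by (simp add: evar_def pvar_def of_epoly_single)
qed

lemma cpoly_ring_induct [case_names const var add mult]: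
  fixes p :: cpoly
  assumes "\<And>c. P (pconst c)" and "\<And>i. P (pvar i)"
    and add: "\<And>p q. P p \<Longrightarrow> P q \<Longrightarrow> P (p + q)"
    and mult: "\<And>p q. P p \<Longrightarrow> P q \<Longrightarrow> P (p * q)"
  shows "P p"
proof (induction p rule: cpoly_induct)
  case (single m c)
  have pow: "P (pvar i ^ n)" for i n
    by (induction n) (use assms(1)[of 1] in \<open>auto intro: mult assms(2)\<close>)
  have "P (\<Prod>i\<in>A. pvar i ^ lookup m i)" for A
    by (induction A rule: infinite_finite_induct)
      (use assms(1)[of 1] in \<open>auto intro: mult pow\<close>)
  from this[of "keys m"] have "P (Poly_Mapping.single m 1)"
    using poly_mapping_as_sum_single[of "keys m" m] by (simp add: prod_pvar_power)
  from mult[OF assms(1)[of c] this] show ?case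
    by (simp add: pconst_def mult_single)
qed (rule add)

section \<open>Elementary symmetric polynomials\<close>

text \<open>
  The \<open>n\<close>-th elementary symmetric polynomial in the variables with index in \<open>A\<close>; a set of
  indices rather than their number, so that single variables can be left out.
\<close>

definition esp :: "nat \<Rightarrow> nat set \<Rightarrow> cpoly" where
  "esp n A = (\<Sum>I | I \<subseteq> A \<and> card I = n. \<Prod>i\<in>I. pvar i)"

lemma in_N_vars_elem_sym: "in_N_vars (elem_sym n) N = esp n {..<N}"
  by (simp add: elem_sym.rep_eq esp_def)

lemma esp_0 [simp]: "finite A \<Longrightarrow> esp 0 A = 1"
proof -
  assume "finite A"
  then have "{I. I \<subseteq> A \<and> card I = 0} = {{}}"
    using finite_subset[of _ A] by auto
  then show ?thesis by (simp add: esp_def)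
qed

lemma esp_eq_0:
  assumes "finite A" "card A < n"
  shows "esp n A = 0"
proof -
  have "{I. I \<subseteq> A \<and> card I = n} = {}"
    using assms card_mono leD by blast
  then show ?thesis by (simp only: esp_def sum.empty)
qed

lemma esp_insert:
  assumes "finite A" "a \<notin> A"
  shows "esp (Suc n) (insert a A) = esp (Suc n) A + pvar a * esp n A"
proof -
  have fin: "finite I" if "I \<subseteq> A" for I using finite_subset[OF that] assms by blast
  have eq: "{I. I \<subseteq> insert a A \<and> card I = Suc n} =
      {I. I \<subseteq> A \<and> card I = Suc n} \<union> insert a ` {I. I \<subseteq> A \<and> card I = n}" (is "?L = ?R1 \<union> ?R2")
  proof (intro equalityI subsetI)
    fix I assume I: "I \<in> ?L"
    show "I \<in> ?R1 \<union> ?R2"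
    proof (cases "a \<in> I")
      case True
      have fI: "finite I" using I assms finite_subset[of I "insert a A"] by simp
      then have "card (I - {a}) = n" "I - {a} \<subseteq> A" "I = insert a (I - {a})"
        using I True by auto
      then show ?thesis by blast
    next
      case False
      then show ?thesis using I by blast
    qed
  next
    fix I assume "I \<in> ?R1 \<union> ?R2"
    then show "I \<in> ?L"
      using fin assms by (auto simp: card_insert_if)
  qed
  have inj: "inj_on (insert a) {I. I \<subseteq> A \<and> card I = n}"
    using assms by (auto intro!: inj_onI)
  have "?R1 \<inter> ?R2 = {}" using assms by blast
  moreover have "finite ?R1" "finite ?R2" using assms by auto
  ultimately have "esp (Suc n) (insert a A) = esp (Suc n) A + (\<Sum>I\<in>?R2. \<Prod>i\<in>I. pvar i)"
    unfolding esp_def eq by (rule sum.union_disjoint[rotated 2])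
  also have "(\<Sum>I\<in>?R2. \<Prod>i\<in>I. pvar i) = pvar a * esp n A"
    unfolding esp_def sum_distrib_left sum.reindex[OF inj] o_def
  proof (intro sum.cong refl)
    fix I assume "I \<in> {I. I \<subseteq> A \<and> card I = n}"
    then have "finite I" "a \<notin> I" using fin assms by auto
    then show "(\<Prod>i\<in>insert a I. pvar i) = pvar a * (\<Prod>i\<in>I. pvar i)" by simp
  qed
  finally show ?thesis .
qed

lemma esp_remove:
  assumes "finite A" "a \<in> A"
  shows "esp (Suc n) A = esp (Suc n) (A - {a}) + pvar a * esp n (A - {a})"
proof -
  have "insert a (A - {a}) = A" using assms by blast
  with esp_insert[of "A - {a}" a n] assms show ?thesis by simp
qed

lemma pderiv_var_esp_notin: "i \<notin> A \<Longrightarrow> pderiv_var i (esp n A) = 0"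
proof -
  assume i: "i \<notin> A"
  have "pderiv_var i (\<Prod>j\<in>I. pvar j) = 0" if "i \<notin> I" for I
    using that by (induction I rule: infinite_finite_induct)
      (auto simp: pderiv_var_mult pderiv_var_pvar)
  then show ?thesis
    unfolding esp_def pderiv_var_sum by (intro sum.neutral) (use i in auto)
qed

lemma pderiv_var_esp:
  "finite A \<Longrightarrow> i \<in> A \<Longrightarrow> pderiv_var i (esp (Suc n) A) = esp n (A - {i})"
  by (simp add: esp_remove[of A i n] pderiv_var_add pderiv_var_mult pderiv_var_pvar
      pderiv_var_esp_notin)

lemma sum_esp_remove:
  assumes "finite A"
  shows "(\<Sum>i\<in>A. esp n (A - {i})) = (of_nat (card A) - of_nat n) * esp n A"
  using assms
proof (induction A arbitrary: n rule: finite_induct)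
  case empty
  then show ?case by (cases n) (simp_all add: esp_eq_0)
next
  case (insert a A)
  have rem: "insert a A - {i} = insert a (A - {i})" if "i \<in> A" for i
    using that insert.hyps by auto
  show ?case
  proof (cases n)
    case 0
    then show ?thesis using insert.hyps by simp
  next
    case (Suc k)
    have "(\<Sum>i\<in>insert a A. esp n (insert a A - {i})) =
        esp n A + (\<Sum>i\<in>A. esp n (A - {i}) + pvar a * esp k (A - {i}))"
      using insert.hyps by (simp add: rem Suc esp_insert)
    also have "\<dots> = (of_nat (card (insert a A)) - of_nat n) * esp n (insert a A)"
      unfolding sum.distrib sum_distrib_left[symmetric] insert.IH
      using insert.hyps by (simp add: Suc esp_insert algebra_simps)
    finally show ?thesis .
  qed
qed

text \<open>
  Write \<open>e\<^sup>i\<close> for the elementary symmetric polynomials without the variable \<open>x\<^sub>i\<close> and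
  \<open>G m n = \<Sum>\<^sub>i x\<^sub>i e\<^sup>i\<^sub>m e\<^sup>i\<^sub>n\<close>.  Replace \<open>x\<^sub>i e\<^sup>i\<^sub>m\<close> by
  \<open>e\<^sub>m\<^sub>+\<^sub>1 - e\<^sup>i\<^sub>m\<^sub>+\<^sub>1\<close> in \<open>G m (n + 1)\<close> and \<open>x\<^sub>i e\<^sup>i\<^sub>n\<close> by
  \<open>e\<^sub>n\<^sub>+\<^sub>1 - e\<^sup>i\<^sub>n\<^sub>+\<^sub>1\<close> in \<open>G (m + 1) n\<close>: the products
  \<open>e\<^sup>i\<^sub>m\<^sub>+\<^sub>1 e\<^sup>i\<^sub>n\<^sub>+\<^sub>1\<close> cancel in the difference, and the rest is summed by \<open>sum_esp_remove\<close>.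
\<close>

lemma sum_var_esp_esp_step:
  assumes A: "finite A"
  shows "(\<Sum>i\<in>A. pvar i * esp m (A - {i}) * esp (Suc n) (A - {i})) =
    (\<Sum>i\<in>A. pvar i * esp (Suc m) (A - {i}) * esp n (A - {i}))
    + (of_nat m - of_nat n) * esp (Suc m) A * esp (Suc n) A"
proof -
  have "(\<Sum>i\<in>A. pvar i * esp m (A - {i}) * esp (Suc n) (A - {i}))
      - (\<Sum>i\<in>A. pvar i * esp (Suc m) (A - {i}) * esp n (A - {i})) =
      (\<Sum>i\<in>A. esp (Suc m) A * esp (Suc n) (A - {i}) - esp (Suc n) A * esp (Suc m) (A - {i}))"
    unfolding sum_subtractf[symmetric]
    by (intro sum.cong refl) (simp add: esp_remove[OF A] algebra_simps)
  also have "\<dots> = (of_nat m - of_nat n) * esp (Suc m) A * esp (Suc n) A"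
    unfolding sum_subtractf sum_distrib_left[symmetric] sum_esp_remove[OF A]
    by (simp add: algebra_simps)
  finally show ?thesis by (simp add: algebra_simps)
qed

lemma sum_var_esp_esp:
  assumes A: "finite A" and "n \<le> m"
  shows "(\<Sum>i\<in>A. pvar i * esp m (A - {i}) * esp n (A - {i})) =
    (\<Sum>k=0..n. of_nat (m + n + 1 - 2 * k) * esp (m + n + 1 - k) A * esp k A)"
  using \<open>n \<le> m\<close>
proof (induction n arbitrary: m)
  case 0
  have "(\<Sum>i\<in>A. pvar i * esp m (A - {i})) = (\<Sum>i\<in>A. esp (Suc m) A - esp (Suc m) (A - {i}))"
    by (intro sum.cong refl) (simp add: esp_remove[OF A])
  also have "\<dots> = of_nat (Suc m) * esp (Suc m) A"
    by (simp add: sum_subtractf sum_esp_remove[OF A] algebra_simps)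
  finally show ?case using A by simp
next
  case (Suc n)
  then have "of_nat m - of_nat n = (of_nat (m - n) :: cpoly)" by (simp add: of_nat_diff)
  moreover have "m + Suc n + 1 - 2 * Suc n = m - n" "m + Suc n + 1 - Suc n = Suc m" by simp_all
  ultimately show ?case
    using Suc.IH[of "Suc m"] Suc.prems
    by (simp add: sum_var_esp_esp_step[OF A])
qed

section \<open>The chain rule\<close>

text \<open>The polynomial \<open>p\<close> in the elementary symmetric functions, as a polynomial in
  \<open>x\<^sub>1, \<dots>, x\<^sub>N\<close>.\<close>

definition at_esp :: "nat \<Rightarrow> cpoly \<Rightarrow> cpoly" where
  "at_esp N p = in_N_vars (of_epoly p) N"

lemma at_esp_add: "at_esp N (p + q) = at_esp N p + at_esp N q"
  and at_esp_mult: "at_esp N (p * q) = at_esp N p * at_esp N q"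
  and at_esp_pconst [simp]: "at_esp N (pconst c) = pconst c"
  and at_esp_0 [simp]: "at_esp N 0 = 0"
  and at_esp_1 [simp]: "at_esp N 1 = 1"
  and at_esp_evar: "at_esp N (evar n) = esp n {..<N}"
  by (simp_all add: at_esp_def of_epoly_add of_epoly_mult in_N_vars_add in_N_vars_mult
      of_epoly_pconst in_N_vars_sym_scale of_epoly_evar in_N_vars_elem_sym)

lemma at_esp_of_nat [simp]: "at_esp N (of_nat n) = of_nat n"
  by (induction n) (simp_all add: at_esp_add)

lemma at_esp_uminus: "at_esp N (- p) = - at_esp N p"
  using at_esp_add[of N p "- p"] by (simp add: add_eq_0_iff)

lemma at_esp_sum: "at_esp N (\<Sum>x\<in>A. f x) = (\<Sum>x\<in>A. at_esp N (f x))"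
  by (simp add: at_esp_def of_epoly_sum in_N_vars_sum)

lemma at_esp_pvar: "at_esp N (pvar k) = esp (Suc k) {..<N}"
  using at_esp_evar[of N "Suc k"] by (simp add: evar_def)

text \<open>
  Only the derivatives with respect to \<open>e\<^sub>1, \<dots>, e\<^sub>N\<close> occur, because the other elementary
  symmetric functions vanish in \<open>N\<close> variables.
\<close>

lemma pderiv_var_at_esp:
  assumes i: "i < N"
  shows "pderiv_var i (at_esp N p) =
    (\<Sum>k<N. esp k ({..<N} - {i}) * at_esp N (pderiv_var k p))"
proof (induction p rule: cpoly_ring_induct)
  case (var j)
  have "esp j ({..<N} - {i}) = 0" if "\<not> j < N"
    using that i by (intro esp_eq_0) auto
  moreover have "(\<Sum>k<N. esp k ({..<N} - {i}) * at_esp N (pderiv_var k (pvar j))) =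
      (\<Sum>k<N. if k = j then esp k ({..<N} - {i}) else 0)"
    by (intro sum.cong refl) (simp add: pderiv_var_pvar)
  ultimately show ?case
    using i by (auto simp: at_esp_pvar pderiv_var_esp)
next
  case (mult p q)
  have "(\<Sum>k<N. esp k ({..<N} - {i}) * at_esp N (pderiv_var k (p * q))) =
      (\<Sum>k<N. esp k ({..<N} - {i}) * at_esp N (pderiv_var k p)) * at_esp N q +
      at_esp N p * (\<Sum>k<N. esp k ({..<N} - {i}) * at_esp N (pderiv_var k q))"
    unfolding sum_distrib_left sum_distrib_right sum.distrib[symmetric]
    by (intro sum.cong refl) (simp only: pderiv_var_mult at_esp_add at_esp_mult algebra_simps)
  then show ?case
    by (simp only: at_esp_mult pderiv_var_mult mult.IH)
next
  case (add p q)
  then show ?case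
    by (simp only: pderiv_var_add at_esp_add sum.distrib distrib_left)
qed simp

section \<open>Alternants\<close>

text \<open>The exponent vector of the monomial \<open>\<Prod>i<N. x\<^sub>i ^ l i\<close>.\<close>

definition expo :: "nat \<Rightarrow> (nat \<Rightarrow> nat) \<Rightarrow> (nat \<Rightarrow>\<^sub>0 nat)" where
  "expo N l = (\<Sum>i<N. Poly_Mapping.single i (l i))"

lemma lookup_expo: "lookup (expo N l) j = (if j < N then l j else 0)"
  by (simp add: expo_def lookup_sum_single)

lemma expo_eq_iff: "expo N l = expo N l' \<longleftrightarrow> (\<forall>i<N. l i = l' i)"
  by (auto simp: poly_mapping_eq_iff fun_eq_iff lookup_expo)

lemma keys_expo: "keys (expo N l) \<subseteq> {..<N}"
  by (auto simp: in_keys_iff lookup_expo split: if_splits)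

lemma mon_deg_expo: "mon_deg (expo N l) = (\<Sum>i<N. l i)"
  by (simp add: mon_deg_superset[OF _ keys_expo] lookup_expo)

text \<open>The monomial \<open>\<Prod>i<N. x\<^sub>i ^ l i\<close> itself.\<close>

definition xmono :: "nat \<Rightarrow> (nat \<Rightarrow> nat) \<Rightarrow> cpoly" where
  "xmono N l = Poly_Mapping.single (expo N l) 1"

lemma prod_pvar_eq_xmono: "(\<Prod>i<N. pvar i ^ l i) = xmono N l"
  by (simp add: xmono_def expo_def prod_pvar_power)

text \<open>
  The alternant with arbitrary exponents \<open>l 0, \<dots>, l (N - 1)\<close>.
\<close>

definition alt :: "nat \<Rightarrow> (nat \<Rightarrow> nat) \<Rightarrow> cpoly" where
  "alt N l = det (mat N N (\<lambda>(i, j). pvar i ^ l j))"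

lemma alternant_eq_alt: "alternant N \<nu> = alt N (\<lambda>j. part \<nu> j + (N - 1 - j))"
  by (simp add: alternant_def alt_def)

lemma alt_expand:
  "alt N l = (\<Sum>\<sigma> | \<sigma> permutes {..<N}. of_int (sign \<sigma>) * xmono N (l \<circ> \<sigma>))"
proof -
  have "alt N l = (\<Sum>\<sigma> | \<sigma> permutes {..<N}. of_int (sign \<sigma>) * (\<Prod>i<N. pvar i ^ l (\<sigma> i)))"
    unfolding alt_def det_def
    by (auto simp: lessThan_atLeast0 intro!: sum.cong prod.cong dest: permutes_in_image)
  then show ?thesis by (simp add: prod_pvar_eq_xmono o_def)
qed

lemma alt_cong: "(\<And>j. j < N \<Longrightarrow> l j = l' j) \<Longrightarrow> alt N l = alt N l'"
  unfolding alt_def by (intro arg_cong[of _ _ det] cong_mat) auto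

lemma alt_eq_0:
  assumes "i < j" "j < N" "l i = l j"
  shows "alt N l = 0"
proof -
  let ?A = "mat N N (\<lambda>(i, j). pvar i ^ l j)"
  have "row (transpose_mat ?A) i = row (transpose_mat ?A) j"
    using assms by (intro eq_vecI) auto
  then have "det (transpose_mat ?A) = 0"
    using assms by (intro det_identical_rows[of _ N i j]) auto
  then show ?thesis
    by (simp add: alt_def det_transpose[of _ N])
qed

text \<open>The exponents decrease, \<open>l 0 > \<dots> > l (N - 1)\<close>; the other values of \<open>l\<close> are irrelevant.\<close>

definition strict_dec :: "nat \<Rightarrow> (nat \<Rightarrow> nat) \<Rightarrow> bool" where
  "strict_dec N l \<longleftrightarrow> (\<forall>i j. i < j \<longrightarrow> j < N \<longrightarrow> l j < l i)"

lemma increasing_permutation_id: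
  fixes \<sigma> :: "nat \<Rightarrow> nat"
  assumes \<sigma>: "\<sigma> permutes {..<N}" and inc: "\<And>i j. i < j \<Longrightarrow> j < N \<Longrightarrow> \<sigma> i < \<sigma> j"
  shows "\<sigma> = id"
proof -
  have ge: "i < N \<Longrightarrow> i \<le> \<sigma> i" for i
  proof (induction i)
    case (Suc i)
    then show ?case using inc[of i "Suc i"] by simp
  qed simp
  have "(\<Sum>i<N. \<sigma> i) = (\<Sum>i<N. i)"
    using sum.permute[OF \<sigma>, of "\<lambda>i. i"] by (simp add: o_def)
  then have "i < N \<Longrightarrow> \<sigma> i = i" for i
    using sum_mono_inv[of "\<lambda>i. i" "{..<N}" \<sigma> i] ge by auto
  moreover have "\<not> i < N \<Longrightarrow> \<sigma> i = i" for i
    using permutes_not_in[OF \<sigma>] by simp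
  ultimately show ?thesis by (auto simp: fun_eq_iff)
qed

lemma lookup_alt:
  "lookup (alt N l) m = (\<Sum>\<sigma> | \<sigma> permutes {..<N}. of_int (sign \<sigma>) when expo N (l \<circ> \<sigma>) = m)"
proof -
  have "of_int (sign \<sigma>) * xmono N k = Poly_Mapping.single (expo N k) (of_int (sign \<sigma>))"
    for \<sigma> :: "nat \<Rightarrow> nat" and k
    by (simp add: sign_def xmono_def single_uminus)
  then show ?thesis
    by (simp add: alt_expand lookup_sum lookup_single)
qed

text \<open>
  The alternants with strictly decreasing exponents are dual to the coefficients at strictly
  decreasing exponents: no permutation other than the identity preserves the order.
\<close>

lemma lookup_alt_strict_dec:
  assumes "strict_dec N l" "strict_dec N l'"
  shows "lookup (alt N l) (expo N l') = (if \<forall>i<N. l i = l' i then 1 else 0)"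
proof -
  have id: "\<sigma> = id" if \<sigma>: "\<sigma> permutes {..<N}" and eq: "expo N (l \<circ> \<sigma>) = expo N l'" for \<sigma>
  proof (rule increasing_permutation_id[OF \<sigma>])
    fix i j :: nat assume ij: "i < j" "j < N"
    then have "l' j < l' i" using assms(2) by (simp add: strict_dec_def)
    moreover have "l (\<sigma> i) = l' i" "l (\<sigma> j) = l' j"
      using eq ij by (auto simp: expo_eq_iff)
    ultimately have less: "l (\<sigma> j) < l (\<sigma> i)" by simp
    have "\<sigma> i < N" using permutes_in_image[OF \<sigma>, of i] ij by simp
    then have "\<not> \<sigma> j < \<sigma> i" "\<sigma> j \<noteq> \<sigma> i"
      using assms(1) less unfolding strict_dec_def by (metis less_asym, metis less_irrefl)
    then show "\<sigma> i < \<sigma> j" by simp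
  qed
  have "lookup (alt N l) (expo N l') =
      (\<Sum>\<sigma> | \<sigma> permutes {..<N}. if \<sigma> = id then (1 when expo N l = expo N l') else 0)"
    unfolding lookup_alt
  proof (rule sum.cong[OF refl])
    fix \<sigma> assume "\<sigma> \<in> {\<sigma>. \<sigma> permutes {..<N}}"
    then show "(of_int (sign \<sigma>) when expo N (l \<circ> \<sigma>) = expo N l') =
        (if \<sigma> = id then 1 when expo N l = expo N l' else 0 :: complex)"
      using id[of \<sigma>] by (cases "\<sigma> = id") (auto simp: sign_id)
  qed
  also have "\<dots> = (1 when expo N l = expo N l')"
    by (subst sum.delta) (auto simp: finite_permutations permutes_id)
  finally show ?thesis by (simp add: expo_eq_iff when_def)
qed

lemma sum_subsets_permute:
  assumes \<sigma>: "\<sigma> permutes A"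
  shows "(\<Sum>I | I \<subseteq> A \<and> card I = n. g (\<sigma> ` I)) = (\<Sum>I | I \<subseteq> A \<and> card I = n. g I)"
proof (rule sum.reindex_bij_witness[where i = "image (Hilbert_Choice.inv \<sigma>)" and j = "image \<sigma>"])
  note \<sigma>' = permutes_inv[OF \<sigma>]
  show "Hilbert_Choice.inv \<sigma> ` \<sigma> ` I = I" "\<sigma> ` Hilbert_Choice.inv \<sigma> ` I = I" for I
    using permutes_inv_o[OF \<sigma>] by (simp_all add: image_comp)
  have "\<tau> ` I \<in> {I. I \<subseteq> A \<and> card I = n}"
    if "\<tau> permutes A" "I \<in> {I. I \<subseteq> A \<and> card I = n}" for \<tau> I
    using that permutes_in_image[OF that(1)] card_image[OF permutes_inj_on[OF that(1)]] by auto
  from this[OF \<sigma>] this[OF \<sigma>']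
  show "I \<in> {I. I \<subseteq> A \<and> card I = n} \<Longrightarrow> \<sigma> ` I \<in> {I. I \<subseteq> A \<and> card I = n}"
    "I \<in> {I. I \<subseteq> A \<and> card I = n} \<Longrightarrow> Hilbert_Choice.inv \<sigma> ` I \<in> {I. I \<subseteq> A \<and> card I = n}" for I
    by blast+
qed (rule refl)

text \<open>The Pieri rule for a column; alternants with a repeated exponent vanish.\<close>

lemma esp_times_alt:
  "esp n {..<N} * alt N l =
     (\<Sum>J | J \<subseteq> {..<N} \<and> card J = n. alt N (\<lambda>j. l j + (if j \<in> J then 1 else 0)))"
proof -
  have single: "(\<Prod>i\<in>I. pvar i) * xmono N k = xmono N (\<lambda>i. k i + (if i \<in> I then 1 else 0))"
    if "I \<subseteq> {..<N}" for I k
  proof -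
    have "(\<Prod>i\<in>I. pvar i) = (\<Prod>i<N. if i \<in> I then pvar i else 1)"
      using that by (simp add: prod.If_cases Int_absorb1)
    then show ?thesis
      unfolding prod_pvar_eq_xmono[symmetric]
      by (simp add: prod.distrib[symmetric] power_add mult.commute if_distrib cong: if_cong)
  qed
  have "esp n {..<N} * alt N l =
      (\<Sum>\<sigma> | \<sigma> permutes {..<N}. \<Sum>I | I \<subseteq> {..<N} \<and> card I = n.
         of_int (sign \<sigma>) * xmono N (\<lambda>i. l (\<sigma> i) + (if i \<in> I then 1 else 0)))"
    unfolding alt_expand esp_def sum_product
    by (subst sum.swap) (intro sum.cong refl, simp add: single[symmetric] o_def)
  also have "\<dots> = (\<Sum>\<sigma> | \<sigma> permutes {..<N}. \<Sum>J | J \<subseteq> {..<N} \<and> card J = n.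
         of_int (sign \<sigma>) * xmono N ((\<lambda>j. l j + (if j \<in> J then 1 else 0)) \<circ> \<sigma>))"
  proof (rule sum.cong[OF refl])
    fix \<sigma> assume "\<sigma> \<in> {\<sigma>. \<sigma> permutes {..<N}}"
    then have \<sigma>: "\<sigma> permutes {..<N}" by simp
    have "\<sigma> i \<in> \<sigma> ` I \<longleftrightarrow> i \<in> I" for i I
      using permutes_inj[OF \<sigma>] by (simp add: inj_image_mem_iff)
    then show "(\<Sum>I | I \<subseteq> {..<N} \<and> card I = n.
         of_int (sign \<sigma>) * xmono N (\<lambda>i. l (\<sigma> i) + (if i \<in> I then 1 else 0))) =
       (\<Sum>J | J \<subseteq> {..<N} \<and> card J = n.
         of_int (sign \<sigma>) * xmono N ((\<lambda>j. l j + (if j \<in> J then 1 else 0)) \<circ> \<sigma>))"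
      by (subst sum_subsets_permute[OF \<sigma>, symmetric]) (simp add: o_def)
  qed
  also have "\<dots> = (\<Sum>J | J \<subseteq> {..<N} \<and> card J = n. alt N (\<lambda>j. l j + (if j \<in> J then 1 else 0)))"
    unfolding alt_expand by (rule sum.swap)
  finally show ?thesis .
qed

text \<open>The Vandermonde determinant.\<close>

definition vdm :: "nat \<Rightarrow> cpoly" where
  "vdm N = alt N (\<lambda>j. N - 1 - j)"

lemma esp_times_vdm:
  assumes "n \<le> N"
  shows "esp n {..<N} * vdm N = alt N (\<lambda>j. N - 1 - j + (if j < n then 1 else 0))"
proof -
  let ?g = "\<lambda>J. alt N (\<lambda>j. N - 1 - j + (if j \<in> J then 1 else 0))"
  have "?g J = 0" if J: "J \<subseteq> {..<N}" "card J = n" "J \<noteq> {..<n}" for J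
  proof -
    \<comment> \<open>A set which is not an initial segment has a gap, where two exponents coincide.\<close>
    have "\<exists>j. j \<notin> J \<and> Suc j \<in> J"
    proof (rule ccontr)
      assume "\<not> ?thesis"
      then have down: "Suc j \<in> J \<Longrightarrow> j \<in> J" for j by blast
      have down': "i \<le> j \<Longrightarrow> j \<in> J \<Longrightarrow> i \<in> J" for i j
        by (induction rule: dec_induct) (auto dest: down)
      have fin: "finite J" using J(1) finite_subset by blast
      have "J \<subseteq> {..<n}"
      proof
        fix j assume "j \<in> J"
        then have "{..j} \<subseteq> J" using down' by auto
        from card_mono[OF fin this] show "j \<in> {..<n}" using J(2) by simp
      qed
      then show False using J card_subset_eq[of "{..<n}" J] by simp
    qed
    then obtain j where "j \<notin> J" "Suc j \<in> J" by blast
    then show ?thesis using J(1) by (intro alt_eq_0[of j "Suc j"]) auto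
  qed
  then have "(\<Sum>J | J \<subseteq> {..<N} \<and> card J = n. ?g J) =
      (\<Sum>J | J \<subseteq> {..<N} \<and> card J = n. if J = {..<n} then ?g J else 0)"
    by (intro sum.cong refl) auto
  also have "\<dots> = ?g {..<n}"
    using assms by (subst sum.delta) auto
  finally show ?thesis
    by (simp add: vdm_def esp_times_alt)
qed

lemma strict_dec_delta: "strict_dec N (\<lambda>j. N - 1 - j)"
  by (auto simp: strict_dec_def)

lemma vdm_nonzero: "vdm N \<noteq> 0"
proof -
  have "lookup (vdm N) (expo N (\<lambda>j. N - 1 - j)) = 1"
    by (simp only: vdm_def lookup_alt_strict_dec[OF strict_dec_delta strict_dec_delta]) simp
  then show ?thesis by force
qed

section \<open>The Laguerre operator in finitely many variables\<close>

text \<open>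
  The sum over the \<open>N\<close> variables of the Laguerre differential operators
  \<open>x \<partial>\<^sup>2 + (b + 1 - x) \<partial>\<close>.
\<close>

definition lag :: "nat \<Rightarrow> complex \<Rightarrow> cpoly \<Rightarrow> cpoly" where
  "lag N b f = (\<Sum>i<N. pvar i * pderiv_var i (pderiv_var i f)
     + pconst (b + 1) * pderiv_var i f - pvar i * pderiv_var i f)"

lemma lag_add: "lag N b (f + g) = lag N b f + lag N b g"
  by (simp add: lag_def pderiv_var_add algebra_simps sum.distrib sum_subtractf)

lemma lag_0 [simp]: "lag N b 0 = 0"
  by (simp add: lag_def)

lemma lag_sum: "lag N b (\<Sum>x\<in>A. f x) = (\<Sum>x\<in>A. lag N b (f x))"
  by (induction A rule: infinite_finite_induct) (simp_all add: lag_add)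

lemma lag_pconst: "lag N b (pconst c * f) = pconst c * lag N b f"
  by (simp add: lag_def pderiv_var_mult sum_distrib_left algebra_simps)

lemma lag_xmono:
  "lag N b (xmono N l) =
     (\<Sum>i<N. pconst (of_nat (l i) * (of_nat (l i) + b)) * xmono N (l(i := l i - 1)))
     - of_nat (\<Sum>i<N. l i) * xmono N l"
proof -
  have "pvar i * pderiv_var i (pderiv_var i (xmono N l)) + pconst (b + 1) * pderiv_var i (xmono N l)
      - pvar i * pderiv_var i (xmono N l) =
      pconst (of_nat (l i) * (of_nat (l i) + b)) * xmono N (l(i := l i - 1))
      - of_nat (l i) * xmono N l" if "i < N" for i
  proof -
    define e where "e = expo N l"
    define s where "s = Poly_Mapping.single i (1::nat)"
    define e' where "e' = expo N (l(i := l i - 1))"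
    have d1: "e - s = e'"
      unfolding e_def s_def e'_def using that
      by (intro poly_mapping_eqI) (auto simp: lookup_minus lookup_expo lookup_single when_def)
    have li: "lookup e i = l i" "lookup e' i = l i - 1"
      using that by (simp_all add: e_def e'_def lookup_expo)
    have d2: "s + e' = e" if "l i > 0"
      unfolding e_def s_def e'_def using that \<open>i < N\<close>
      by (intro poly_mapping_eqI) (auto simp: lookup_add lookup_expo lookup_single when_def)
    have d3: "s + (e' - s) = e'" if "l i > 1"
      unfolding s_def e'_def using that \<open>i < N\<close>
      by (intro poly_mapping_eqI)
        (auto simp: lookup_add lookup_minus lookup_expo lookup_single when_def)
    have D1: "pderiv_var i (xmono N l) = Poly_Mapping.single e' (of_nat (l i))"
      unfolding xmono_def e_def[symmetric] pderiv_var_single s_def[symmetric] d1 li by simp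
    have D2: "pderiv_var i (pderiv_var i (xmono N l)) =
        Poly_Mapping.single (e' - s) (of_nat (l i - 1) * of_nat (l i))"
      unfolding D1 pderiv_var_single li s_def ..
    have X1: "pvar i * Poly_Mapping.single k c = Poly_Mapping.single (s + k) c" for k c
      by (simp add: pvar_def s_def mult_single)
    have X2: "pvar i * pderiv_var i (pderiv_var i (xmono N l)) =
        Poly_Mapping.single e' (of_nat (l i) * (of_nat (l i) - 1))"
    proof (cases "l i > 1")
      case True
      then show ?thesis unfolding D2 X1 d3[OF True] by (simp add: of_nat_diff mult.commute)
    next
      case False
      then have "l i = 0 \<or> l i = 1" by auto
      then show ?thesis unfolding D2 by auto
    qed
    have X3: "pvar i * pderiv_var i (xmono N l) = Poly_Mapping.single e (of_nat (l i))"
      unfolding D1 X1 using d2 by (cases "l i = 0") auto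
    have "pvar i * pderiv_var i (pderiv_var i (xmono N l)) + pconst (b + 1) * pderiv_var i (xmono N l)
      = Poly_Mapping.single e' (of_nat (l i) * (of_nat (l i) - 1) + (b + 1) * of_nat (l i))"
      unfolding X2 unfolding D1
      by (simp only: pconst_def mult_single single_add[symmetric] add_0)
    also have "\<dots> = pconst (of_nat (l i) * (of_nat (l i) + b)) * xmono N (l(i := l i - 1))"
      unfolding xmono_def e'_def[symmetric] pconst_def mult_single by (simp add: algebra_simps)
    finally show ?thesis
      unfolding X3 by (simp only: xmono_def e_def[symmetric] single_of_nat[symmetric] mult_single
          add_0 mult_1_right)
  qed
  then show ?thesis
    unfolding lag_def by (simp add: sum_subtractf sum_distrib_right)
qed

lemma lag_alt:
  "lag N b (alt N l) =
     (\<Sum>j<N. pconst (of_nat (l j) * (of_nat (l j) + b)) * alt N (l(j := l j - 1)))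
     - of_nat (\<Sum>j<N. l j) * alt N l"
proof -
  let ?c = "\<lambda>j. pconst (of_nat (l j) * (of_nat (l j) + b))"
  have \<sigma>_case: "lag N b (xmono N (l \<circ> \<sigma>)) =
      (\<Sum>j<N. ?c j * xmono N (l(j := l j - 1) \<circ> \<sigma>)) - of_nat (\<Sum>j<N. l j) * xmono N (l \<circ> \<sigma>)"
    if \<sigma>: "\<sigma> permutes {..<N}" for \<sigma>
  proof -
    have "(l \<circ> \<sigma>)(i := l (\<sigma> i) - 1) = l(\<sigma> i := l (\<sigma> i) - 1) \<circ> \<sigma>" for i
      using permutes_inj[OF \<sigma>] by (auto simp: fun_eq_iff inj_eq)
    then have "(\<Sum>i<N. ?c (\<sigma> i) * xmono N ((l \<circ> \<sigma>)(i := l (\<sigma> i) - 1))) =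
        (\<Sum>j<N. ?c j * xmono N (l(j := l j - 1) \<circ> \<sigma>))"
      using sum.permute[OF \<sigma>, of "\<lambda>j. ?c j * xmono N (l(j := l j - 1) \<circ> \<sigma>)"]
      by (simp add: o_def)
    moreover have "(\<Sum>i<N. (l \<circ> \<sigma>) i) = (\<Sum>j<N. l j)"
      using sum.permute[OF \<sigma>, of l] by simp
    ultimately show ?thesis
      by (simp add: lag_xmono)
  qed
  have sgn: "lag N b (of_int (sign \<sigma>) * f) = of_int (sign \<sigma>) * lag N b f"
    for \<sigma> :: "nat \<Rightarrow> nat" and f
    using lag_pconst[of N b "of_int (sign \<sigma>)" f] by (simp add: pconst_def)
  have "lag N b (alt N l) = (\<Sum>\<sigma> | \<sigma> permutes {..<N}. of_int (sign \<sigma>) *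
      ((\<Sum>j<N. ?c j * xmono N (l(j := l j - 1) \<circ> \<sigma>)) - of_nat (\<Sum>j<N. l j) * xmono N (l \<circ> \<sigma>)))"
    unfolding alt_expand lag_sum by (intro sum.cong refl) (simp add: sgn \<sigma>_case)
  also have "\<dots> = (\<Sum>\<sigma> | \<sigma> permutes {..<N}.
        \<Sum>j<N. ?c j * (of_int (sign \<sigma>) * xmono N (l(j := l j - 1) \<circ> \<sigma>)))
      - (\<Sum>\<sigma> | \<sigma> permutes {..<N}. of_nat (\<Sum>j<N. l j) * (of_int (sign \<sigma>) * xmono N (l \<circ> \<sigma>)))"
    unfolding sum_subtractf[symmetric]
    by (intro sum.cong refl) (simp only: right_diff_distrib sum_distrib_left mult.left_commute)
  also have "\<dots> = (\<Sum>j<N. ?c j * alt N (l(j := l j - 1))) - of_nat (\<Sum>j<N. l j) * alt N l"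
    unfolding alt_expand sum_distrib_left by (subst sum.swap) (rule refl)
  finally show ?thesis .
qed

text \<open>The degree \<open>N (N - 1) / 2\<close> of the Vandermonde determinant.\<close>

definition vdeg :: "nat \<Rightarrow> nat" where
  "vdeg N = (\<Sum>j<N. N - 1 - j)"

text \<open>A lowered exponent equal to the next one gives two equal columns.\<close>

lemma lowered_alt_eq_0:
  assumes "j < N" "l j = 0 \<or> (Suc j < N \<and> l j = Suc (l (Suc j)))"
  shows "pconst (of_nat (l j) * c) * alt N (l(j := l j - 1)) = 0"
proof (cases "l j = 0")
  case False
  then have "alt N (l(j := l j - 1)) = 0"
    using assms by (intro alt_eq_0[of j "Suc j"]) auto
  then show ?thesis by simp
qed simp

lemma lag_vdm: "lag N b (vdm N) = - of_nat (vdeg N) * vdm N"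
proof -
  have "(\<Sum>j<N. pconst (of_nat (N - 1 - j) * (of_nat (N - 1 - j) + b)) *
      alt N ((\<lambda>j. N - 1 - j)(j := N - 1 - j - 1))) = 0"
    by (intro sum.neutral ballI lowered_alt_eq_0[where l = "\<lambda>j. N - 1 - j"]) auto
  then show ?thesis
    unfolding vdm_def lag_alt vdeg_def by (simp only: diff_0 minus_mult_left)
qed

text \<open>
  The exponents are those of a column of \<open>k + 1\<close> boxes, and only the last of these can be removed.
\<close>

lemma lag_esp_times_vdm:
  assumes k: "k < N"
  shows "lag N b (esp (Suc k) {..<N} * vdm N) =
    pconst ((of_nat N - of_nat k) * (of_nat N - of_nat k + b)) * (esp k {..<N} * vdm N)
    - of_nat (vdeg N + Suc k) * (esp (Suc k) {..<N} * vdm N)"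
proof -
  define l where "l = (\<lambda>j. N - 1 - j + (if j < Suc k then 1 else 0))"
  have "(\<Sum>j<N. if j < Suc k then 1 else 0) = (\<Sum>j<Suc k. 1::nat)"
    using k by (intro sum.mono_neutral_cong_right) auto
  then have suml: "(\<Sum>j<N. l j) = vdeg N + Suc k"
    by (simp only: l_def vdeg_def sum.distrib) simp
  have V: "alt N l = esp (Suc k) {..<N} * vdm N"
    using k by (simp add: esp_times_vdm l_def)
  have "(\<Sum>j<N. pconst (of_nat (l j) * (of_nat (l j) + b)) * alt N (l(j := l j - 1))) =
      (\<Sum>j<N. if j = k then pconst (of_nat (l k) * (of_nat (l k) + b)) * alt N (l(k := l k - 1)) else 0)"
  proof (rule sum.cong[OF refl])
    fix j assume j: "j \<in> {..<N}"
    show "pconst (of_nat (l j) * (of_nat (l j) + b)) * alt N (l(j := l j - 1)) =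
        (if j = k then pconst (of_nat (l k) * (of_nat (l k) + b)) * alt N (l(k := l k - 1)) else 0)"
    proof (cases "j = k")
      case False
      then have "l j = 0 \<or> (Suc j < N \<and> l j = Suc (l (Suc j)))"
        using j k by (auto simp: l_def)
      then show ?thesis
        using False j lowered_alt_eq_0[of j N l "of_nat (l j) + b"] by simp
    qed simp
  qed
  also have "\<dots> = pconst (of_nat (l k) * (of_nat (l k) + b)) * alt N (l(k := l k - 1))"
    using k by simp
  also have "alt N (l(k := l k - 1)) = esp k {..<N} * vdm N"
    unfolding esp_times_vdm[OF less_imp_le[OF k]] by (rule alt_cong) (auto simp: l_def)
  also have "(of_nat (l k) :: complex) = of_nat N - of_nat k"
    using k by (simp add: l_def of_nat_diff)
  finally show ?thesis
    unfolding V[symmetric] lag_alt suml by (simp only:)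
qed

lemma lag_mult:
  "lag N b (f * g) = lag N b f * g + f * lag N b g
     + 2 * (\<Sum>i<N. pvar i * pderiv_var i f * pderiv_var i g)"
  unfolding lag_def sum_distrib_left sum_distrib_right sum.distrib[symmetric]
  by (intro sum.cong refl) (simp add: pderiv_var_mult pderiv_var_add algebra_simps)

lemma pderiv_var_pderiv_var_at_esp:
  assumes i: "i < N"
  shows "pderiv_var i (pderiv_var i (at_esp N p)) =
    (\<Sum>k<N. \<Sum>j<N. esp k ({..<N} - {i}) * esp j ({..<N} - {i}) *
       at_esp N (pderiv_var k (pderiv_var j p)))"
proof -
  have "pderiv_var i (pderiv_var i (at_esp N p)) =
      (\<Sum>k<N. esp k ({..<N} - {i}) * pderiv_var i (at_esp N (pderiv_var k p)))"
    unfolding pderiv_var_at_esp[OF i] pderiv_var_sum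
    by (intro sum.cong refl) (simp add: pderiv_var_mult pderiv_var_esp_notin
        pderiv_var_at_esp[OF i])
  also have "\<dots> = (\<Sum>k<N. \<Sum>j<N. esp k ({..<N} - {i}) * esp j ({..<N} - {i}) *
       at_esp N (pderiv_var k (pderiv_var j p)))"
    unfolding pderiv_var_at_esp[OF i] sum_distrib_left
    by (intro sum.cong refl) (simp only: pderiv_var_commute mult.assoc)
  finally show ?thesis .
qed

text \<open>The second order coefficient \<open>\<Sum>\<^sub>i x\<^sub>i (\<partial>\<^sub>i e\<^sub>k\<^sub>+\<^sub>1) (\<partial>\<^sub>i e\<^sub>j\<^sub>+\<^sub>1)\<close>.\<close>

definition symbol :: "nat \<Rightarrow> nat \<Rightarrow> nat \<Rightarrow> cpoly" where
  "symbol N k j = (\<Sum>i<N. pvar i * esp k ({..<N} - {i}) * esp j ({..<N} - {i}))"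

lemma lag_at_esp:
  "lag N b (at_esp N p) =
     (\<Sum>k<N. \<Sum>j<N. symbol N k j * at_esp N (pderiv_var k (pderiv_var j p)))
     + (\<Sum>k<N. lag N b (esp (Suc k) {..<N}) * at_esp N (pderiv_var k p))"
proof -
  let ?e = "\<lambda>k i. esp k ({..<N} - {i})" and ?q = "\<lambda>k j. at_esp N (pderiv_var k (pderiv_var j p))"
  have lag_esp: "lag N b (esp (Suc k) {..<N}) = (\<Sum>i<N. (pconst (b + 1) - pvar i) * ?e k i)" for k
    unfolding lag_def
    by (intro sum.cong refl) (simp add: pderiv_var_esp pderiv_var_esp_notin algebra_simps)
  have "lag N b (at_esp N p) = (\<Sum>i<N. pvar i * (\<Sum>k<N. \<Sum>j<N. ?e k i * ?e j i * ?q k j)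
      + (pconst (b + 1) - pvar i) * (\<Sum>k<N. ?e k i * at_esp N (pderiv_var k p)))"
    unfolding lag_def
  proof (rule sum.cong[OF refl])
    fix i assume "i \<in> {..<N}"
    then have i: "i < N" by simp
    show "pvar i * pderiv_var i (pderiv_var i (at_esp N p)) + pconst (b + 1) * pderiv_var i (at_esp N p)
        - pvar i * pderiv_var i (at_esp N p) = pvar i * (\<Sum>k<N. \<Sum>j<N. ?e k i * ?e j i * ?q k j)
        + (pconst (b + 1) - pvar i) * (\<Sum>k<N. ?e k i * at_esp N (pderiv_var k p))"
      unfolding pderiv_var_pderiv_var_at_esp[OF i] unfolding pderiv_var_at_esp[OF i]
      by (simp only: left_diff_distrib add_diff_eq)
  qed
  also have "\<dots> = (\<Sum>i<N. \<Sum>k<N. \<Sum>j<N. pvar i * ?e k i * ?e j i * ?q k j)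
      + (\<Sum>i<N. \<Sum>k<N. (pconst (b + 1) - pvar i) * ?e k i * at_esp N (pderiv_var k p))"
    by (simp only: sum.distrib sum_distrib_left mult.assoc)
  also have "(\<Sum>i<N. \<Sum>k<N. \<Sum>j<N. pvar i * ?e k i * ?e j i * ?q k j) =
      (\<Sum>k<N. \<Sum>j<N. symbol N k j * ?q k j)"
    unfolding symbol_def sum_distrib_right
    by (rule trans[OF sum.swap], rule sum.cong[OF refl], rule sum.swap)
  also have "(\<Sum>i<N. \<Sum>k<N. (pconst (b + 1) - pvar i) * ?e k i * at_esp N (pderiv_var k p)) =
      (\<Sum>k<N. lag N b (esp (Suc k) {..<N}) * at_esp N (pderiv_var k p))"
    unfolding lag_esp sum_distrib_right by (rule sum.swap)
  finally show ?thesis .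
qed

text \<open>
  Up to an additive constant, conjugating by the Vandermonde determinant changes the first order
  coefficients only; they are
  determined by the values at the elementary symmetric polynomials, that is, by
  \<open>lag_esp_times_vdm\<close>.
\<close>

lemma lag_vdm_times_at_esp:
  "lag N b (vdm N * at_esp N p) + of_nat (vdeg N) * (vdm N * at_esp N p) =
     vdm N * ((\<Sum>k<N. \<Sum>j<N. symbol N k j * at_esp N (pderiv_var k (pderiv_var j p)))
       + (\<Sum>k<N. (pconst ((of_nat N - of_nat k) * (of_nat N - of_nat k + b)) * esp k {..<N}
            - of_nat (Suc k) * esp (Suc k) {..<N}) * at_esp N (pderiv_var k p)))"
proof -
  let ?V = "vdm N" and ?S = "\<Sum>k<N. \<Sum>j<N. symbol N k j * at_esp N (pderiv_var k (pderiv_var j p))"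
    and ?F = "\<lambda>k. at_esp N (pderiv_var k p)" and ?e = "\<lambda>k. esp (Suc k) {..<N}"
  let ?c = "\<lambda>k. pconst ((of_nat N - of_nat k) * (of_nat N - of_nat k + b)) * esp k {..<N}
            - of_nat (Suc k) * ?e k"
  define X where "X k = (\<Sum>i<N. pvar i * pderiv_var i ?V * esp k ({..<N} - {i}))" for k
  \<comment> \<open>Both sides are what the product rule for \<open>V e\<^sub>k\<^sub>+\<^sub>1\<close> leaves besides the additive constant.\<close>
  have cross: "2 * X k + ?V * lag N b (?e k) = ?V * ?c k" if k: "k < N" for k
  proof -
    have "(\<Sum>i<N. pvar i * pderiv_var i ?V * pderiv_var i (?e k)) = X k"
      unfolding X_def by (intro sum.cong refl) (simp add: pderiv_var_esp)
    then have "lag N b (?e k * ?V) = - of_nat (vdeg N) * ?V * ?e k + ?V * lag N b (?e k) + 2 * X k"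
      using lag_mult[of N b ?V "?e k"] by (simp only: lag_vdm mult.commute[of "?e k" ?V])
    then have "2 * X k + ?V * lag N b (?e k) =
        lag N b (?e k * ?V) + of_nat (vdeg N) * (?e k * ?V)"
      by (simp add: algebra_simps)
    also have "\<dots> = ?V * ?c k"
      unfolding lag_esp_times_vdm[OF k] by (simp add: algebra_simps)
    finally show ?thesis .
  qed
  have "(\<Sum>i<N. pvar i * pderiv_var i ?V * pderiv_var i (at_esp N p)) =
      (\<Sum>i<N. \<Sum>k<N. pvar i * pderiv_var i ?V * esp k ({..<N} - {i}) * ?F k)"
    by (intro sum.cong refl) (simp add: pderiv_var_at_esp sum_distrib_left mult.assoc)
  also have "\<dots> = (\<Sum>k<N. X k * ?F k)"
    unfolding X_def sum_distrib_right by (rule sum.swap)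
  finally have "lag N b (?V * at_esp N p) + of_nat (vdeg N) * (?V * at_esp N p) =
      ?V * ?S + (\<Sum>k<N. (2 * X k + ?V * lag N b (?e k)) * ?F k)"
    unfolding lag_mult lag_at_esp lag_vdm
    by (simp add: sum_distrib_left sum.distrib distrib_left distrib_right mult.assoc)
  also have "(\<Sum>k<N. (2 * X k + ?V * lag N b (?e k)) * ?F k) = (\<Sum>k<N. ?V * ?c k * ?F k)"
    by (intro sum.cong refl) (simp only: cross lessThan_iff)
  finally show ?thesis
    by (simp only: distrib_left sum_distrib_left mult.assoc)
qed

section \<open>Young diagrams\<close>

lemma downward_closed_eq_lessThan:
  fixes S :: "nat set"
  assumes "finite S" "\<And>x y. x \<in> S \<Longrightarrow> y \<le> x \<Longrightarrow> y \<in> S"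
  shows "S = {..<card S}"
proof (rule card_subset_eq[symmetric, OF assms(1)])
  show "{..<card S} \<subseteq> S"
  proof (rule ccontr)
    assume "\<not> ?thesis"
    then obtain x where "x < card S" "x \<notin> S" by auto
    then have "S \<subseteq> {..<x}" using assms(2) by (auto simp: not_less) (meson not_less)
    from card_mono[OF _ this] show False using \<open>x < card S\<close> by simp
  qed
qed simp

lemma young_diagram_iff_part:
  assumes "young_diagram \<nu>"
  shows "(i, j) \<in> \<nu> \<longleftrightarrow> j < part \<nu> i"
proof -
  let ?S = "{j. (i, j) \<in> \<nu>}"
  have "?S \<subseteq> snd ` \<nu>" by force
  then have "finite ?S" using assms finite_subset unfolding young_diagram_def by blast
  then have "?S = {..<card ?S}"
    using assms by (intro downward_closed_eq_lessThan) (auto simp: young_diagram_def)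
  then show ?thesis by (auto simp: part_def)
qed

lemma fst_young_diagram:
  assumes "young_diagram \<nu>"
  shows "fst ` \<nu> = {..<num_parts \<nu>}"
  unfolding num_parts_def
  using assms by (intro downward_closed_eq_lessThan) (force simp: young_diagram_def)+

lemma part_eq_0_iff:
  assumes "young_diagram \<nu>"
  shows "part \<nu> i = 0 \<longleftrightarrow> num_parts \<nu> \<le> i"
proof -
  have "i \<in> fst ` \<nu> \<longleftrightarrow> (i, 0) \<in> \<nu>"
    using assms by (force simp: young_diagram_def)
  then show ?thesis
    using fst_young_diagram[OF assms] young_diagram_iff_part[OF assms, of i 0] by auto
qed

lemma part_antimono:
  assumes "young_diagram \<nu>" "i \<le> i'"
  shows "part \<nu> i' \<le> part \<nu> i"
proof (rule ccontr)
  assume "\<not> ?thesis"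
  then have "(i', part \<nu> i) \<in> \<nu>" using young_diagram_iff_part[OF assms(1)] by simp
  then have "(i, part \<nu> i) \<in> \<nu>" using assms unfolding young_diagram_def by blast
  then show False using young_diagram_iff_part[OF assms(1)] by simp
qed

lemma young_diagram_eq_Sigma:
  assumes "young_diagram \<nu>" "num_parts \<nu> \<le> N"
  shows "\<nu> = (SIGMA i:{..<N}. {..<part \<nu> i})"
proof -
  have "i < N" if "j < part \<nu> i" for i j
    using that part_eq_0_iff[OF assms(1), of i] assms(2) by (cases "i < N") auto
  then show ?thesis
    using young_diagram_iff_part[OF assms(1)] by auto
qed

lemma card_young_diagram:
  assumes "young_diagram \<nu>" "num_parts \<nu> \<le> N"
  shows "card \<nu> = (\<Sum>i<N. part \<nu> i)"
proof -
  have "card \<nu> = card (SIGMA i:{..<N}. {..<part \<nu> i})"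
    using young_diagram_eq_Sigma[OF assms] by simp
  then show ?thesis by simp
qed

lemma num_parts_le_card: "young_diagram \<nu> \<Longrightarrow> num_parts \<nu> \<le> card \<nu>"
  unfolding num_parts_def young_diagram_def by (auto intro: card_image_le)

lemma finite_young_diagrams: "finite {\<nu>. young_diagram \<nu> \<and> card \<nu> \<le> d}"
proof (rule finite_subset)
  show "{\<nu>. young_diagram \<nu> \<and> card \<nu> \<le> d} \<subseteq> Pow ({..<d} \<times> {..<d})"
  proof (intro subsetI PowI)
    fix \<nu> b assume \<nu>: "\<nu> \<in> {\<nu>. young_diagram \<nu> \<and> card \<nu> \<le> d}" and "b \<in> \<nu>"
    obtain i j where b: "b = (i, j)" by force
    have "(i', j') \<in> \<nu>" if "i' \<le> i" "j' \<le> j" for i' j'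
      using \<nu> \<open>b \<in> \<nu>\<close> b that unfolding young_diagram_def by blast
    then have sub: "(\<lambda>k. (k, j)) ` {..i} \<subseteq> \<nu>" "(\<lambda>k. (i, k)) ` {..j} \<subseteq> \<nu>"
      by auto
    have "finite \<nu>" "card \<nu> \<le> d" using \<nu> by (simp_all add: young_diagram_def)
    with sub have "card ((\<lambda>k. (k, j)) ` {..i}) \<le> d" "card ((\<lambda>k. (i, k)) ` {..j}) \<le> d"
      by (meson card_mono le_trans)+
    then show "b \<in> {..<d} \<times> {..<d}"
      using b by (simp add: card_image inj_on_def)
  qed
qed simp

text \<open>The exponents of the alternant, \<open>\<nu>\<^sub>j + N - 1 - j\<close> with rows \<open>j\<close> counted from 0.\<close>

definition dexp :: "nat \<Rightarrow> (nat \<times> nat) set \<Rightarrow> nat \<Rightarrow> nat" where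
  "dexp N \<nu> j = part \<nu> j + (N - 1 - j)"

lemma alternant_eq_alt_dexp: "alternant N \<nu> = alt N (dexp N \<nu>)"
  by (simp add: alternant_eq_alt dexp_def[abs_def])

lemma alternant_empty: "alternant N {} = vdm N"
  by (simp add: alternant_eq_alt vdm_def part_def)

lemma strict_dec_dexp:
  assumes "young_diagram \<nu>"
  shows "strict_dec N (dexp N \<nu>)"
  unfolding strict_dec_def
proof (intro allI impI)
  fix i j :: nat assume "i < j" "j < N"
  then show "dexp N \<nu> j < dexp N \<nu> i"
    using part_antimono[OF assms, of i j] by (simp add: dexp_def)
qed

lemma dexp_inject:
  assumes "young_diagram \<nu>" "young_diagram \<kappa>" "num_parts \<nu> \<le> N" "num_parts \<kappa> \<le> N"
    and eq: "\<forall>j<N. dexp N \<nu> j = dexp N \<kappa> j"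
  shows "\<nu> = \<kappa>"
proof -
  have "part \<nu> i = part \<kappa> i" if "i < N" for i
    using eq that by (auto simp: dexp_def)
  then have "(SIGMA i:{..<N}. {..<part \<nu> i}) = (SIGMA i:{..<N}. {..<part \<kappa> i})"
    by (intro Sigma_cong) auto
  then show ?thesis
    using young_diagram_eq_Sigma[OF assms(1,3)] young_diagram_eq_Sigma[OF assms(2,4)] by simp
qed

lemma strict_dec_eq_dexp:
  assumes l: "strict_dec N l"
  obtains \<nu> where "young_diagram \<nu>" "num_parts \<nu> \<le> N" "\<forall>j<N. dexp N \<nu> j = l j"
proof -
  define \<nu> where "\<nu> = (SIGMA i:{..<N}. {..<l i - (N - 1 - i)})"
  have desc: "l (Suc j) < l j" if "Suc j < N" for j
    using l that by (simp add: strict_dec_def)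
  have ge: "N - 1 - j \<le> l j" if "j < N" for j
  proof -
    have "j \<le> N - 1" using that by simp
    then show ?thesis
    proof (induction rule: inc_induct)
      case (step n)
      have "l (Suc n) < l n" using step.hyps by (intro desc) simp
      with step.IH show ?case by simp
    qed simp
  qed
  have anti_step: "l (Suc n) - (N - 1 - Suc n) \<le> l n - (N - 1 - n)" if "Suc n < N" for n
    using desc[OF that] that by simp
  have anti: "l j - (N - 1 - j) \<le> l i - (N - 1 - i)" if "i \<le> j" "j < N" for i j
    using that
  proof (induction rule: dec_induct)
    case (step n)
    from step.prems have "n < N" by simp
    from anti_step[OF step.prems] step.IH[OF this] show ?case by (rule le_trans)
  qed (rule le_refl)
  have Y: "young_diagram \<nu>"
    unfolding young_diagram_def
  proof (intro conjI allI impI)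
    show "finite \<nu>" by (simp add: \<nu>_def)
    fix i j i' j' assume "(i, j) \<in> \<nu>" "i' \<le> i" "j' \<le> j"
    then have i: "i < N" and "j < l i - (N - 1 - i)"
      by (simp_all only: \<nu>_def mem_Sigma_iff lessThan_iff)
    from \<open>j' \<le> j\<close> this(2) have "j' < l i - (N - 1 - i)" by (rule le_less_trans)
    also have "\<dots> \<le> l i' - (N - 1 - i')" by (rule anti) fact+
    finally have "j' < l i' - (N - 1 - i')" .
    moreover have "i' < N" using i \<open>i' \<le> i\<close> by simp
    ultimately
    show "(i', j') \<in> \<nu>"
      by (simp only: \<nu>_def mem_Sigma_iff lessThan_iff)
  qed
  have part: "part \<nu> i = l i - (N - 1 - i)" if "i < N" for i
  proof -
    have "{j. (i, j) \<in> \<nu>} = {..<l i - (N - 1 - i)}" using that by (auto simp: \<nu>_def)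
    then show ?thesis by (simp add: part_def)
  qed
  have "fst ` \<nu> \<subseteq> {..<N}" by (auto simp: \<nu>_def)
  from card_mono[OF _ this] have "num_parts \<nu> \<le> N" by (simp add: num_parts_def)
  moreover have "\<forall>j<N. dexp N \<nu> j = l j"
  proof (intro allI impI)
    fix j assume j: "j < N"
    show "dexp N \<nu> j = l j"
      unfolding dexp_def part[OF j] by (rule le_add_diff_inverse2[OF ge[OF j]])
  qed
  ultimately show ?thesis using Y that by blast
qed

section \<open>Schur functions as Jacobi--Trudi determinants\<close>

text \<open>
  The complete symmetric functions, as the coefficients of the inverse of
  \<open>\<Sum>\<^sub>n (-1)\<^sup>n e\<^sub>n t\<^sup>n\<close>; in this way they are symmetric functions without further proof.
\<close>

definition hsym :: "nat \<Rightarrow> symfun" where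
  "hsym n = fps_nth (fps_right_inverse (Abs_fps (\<lambda>n. (- 1) ^ n * elem_sym n)) 1) n"

lemma elem_sym_0: "elem_sym 0 = 1"
  using of_epoly_evar[of 0] by (simp add: evar_def)

lemma hsym_0 [simp]: "hsym 0 = 1"
  by (simp add: hsym_def)

lemma elem_sym_hsym:
  "(\<Sum>k=0..n. (- 1) ^ k * elem_sym k * hsym (n - k)) = (if n = 0 then 1 else 0)"
proof -
  let ?E = "Abs_fps (\<lambda>n. (- 1) ^ n * elem_sym n)"
  have "?E * fps_right_inverse ?E 1 = 1"
    by (rule fps_right_inverse) (simp add: elem_sym_0)
  then have "fps_nth (?E * fps_right_inverse ?E 1) n = (if n = 0 then 1 else 0)"
    by (simp only: fps_one_nth)
  then show ?thesis
    by (simp add: fps_mult_nth hsym_def)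
qed

lemma in_N_vars_minus_1_power [simp]: "in_N_vars ((- 1) ^ k) N = (- 1) ^ k"
  by (induction k) (simp_all add: in_N_vars_mult in_N_vars_uminus)

text \<open>
  With \<open>E(t) = \<Prod>\<^sub>j (1 - x\<^sub>j t)\<close> and \<open>E\<^sub>i(t) = E(t) / (1 - x\<^sub>i t)\<close>, both sides are the
  coefficient of \<open>t\<^sup>l\<close> in \<open>E\<^sub>i(t) / E(t) = 1 / (1 - x\<^sub>i t)\<close>.
\<close>

lemma pvar_power_eq:
  assumes i: "i < N"
  shows "pvar i ^ l = (\<Sum>k=0..l. (- 1) ^ k * esp k ({..<N} - {i}) * in_N_vars (hsym (l - k)) N)"
proof -
  define E where "E = Abs_fps (\<lambda>n. (- 1) ^ n * esp n {..<N})"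
  define Ei where "Ei = Abs_fps (\<lambda>n. (- 1) ^ n * esp n ({..<N} - {i}))"
  define H where "H = Abs_fps (\<lambda>n. in_N_vars (hsym n) N)"
  define G where "G = Abs_fps (\<lambda>n. pvar i ^ n)"
  define L where "L = 1 - fps_const (pvar i) * fps_X"
  have mult_L: "fps_nth (F * L) n = fps_nth F n - (if n = 0 then 0 else pvar i * fps_nth F (n - 1))" for F n
  proof -
    have "F * L = F - fps_const (pvar i) * (fps_X * F)"
      by (simp add: L_def algebra_simps)
    then show ?thesis by simp
  qed
  have "E * H = 1"
  proof (rule fps_ext)
    fix n
    have "in_N_vars (\<Sum>k=0..n. (- 1) ^ k * elem_sym k * hsym (n - k)) N = (if n = 0 then 1 else 0)"
      unfolding elem_sym_hsym by simp
    then show "fps_nth (E * H) n = fps_nth 1 n"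
      by (simp add: E_def H_def fps_mult_nth in_N_vars_sum in_N_vars_mult in_N_vars_elem_sym)
  qed
  moreover have "Ei * L = E"
  proof (rule fps_ext)
    fix n
    have rem: "esp (Suc m) {..<N} = esp (Suc m) ({..<N} - {i}) + pvar i * esp m ({..<N} - {i})" for m
      using i by (intro esp_remove) auto
    show "fps_nth (Ei * L) n = fps_nth E n"
      unfolding mult_L Ei_def E_def by (cases n) (simp_all add: rem algebra_simps)
  qed
  moreover have "G * L = 1"
  proof (rule fps_ext)
    fix n
    show "fps_nth (G * L) n = fps_nth 1 n"
      unfolding mult_L G_def by (cases n) simp_all
  qed
  moreover have "G * (Ei * L * H) = G * L * (Ei * H)"
    by (simp only: mult_ac)
  ultimately have "G = Ei * H" by simp
  then have "fps_nth G l = fps_nth (Ei * H) l" by simp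
  then show ?thesis
    by (simp add: G_def Ei_def H_def fps_mult_nth)
qed

text \<open>
  The Jacobi--Trudi determinant.  For \<open>l j = \<nu>\<^sub>j + N - 1 - j\<close> the entry in row \<open>k\<close> and column
  \<open>j\<close> is \<open>h\<close> with index \<open>\<nu>\<^sub>j - j + k\<close>, and 0 if this is negative.
\<close>

definition jt_det :: "nat \<Rightarrow> (nat \<Rightarrow> nat) \<Rightarrow> symfun" where
  "jt_det N l = det (mat N N (\<lambda>(k, j). if N - 1 - k \<le> l j then hsym (l j - (N - 1 - k)) else 0))"

text \<open>
  By \<open>pvar_power_eq\<close> the matrix of powers is the product of a matrix which does not depend on the
  exponents and the matrix of the Jacobi--Trudi determinant.  For the exponents of the empty diagram
  the latter determinant is 1, so that \<open>c\<close> is the Vandermonde determinant.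
\<close>

lemma alt_eq_jt_det:
  "\<exists>c. \<forall>l. alt N l = c * in_N_vars (jt_det N l) N"
proof (intro exI allI)
  fix l
  let ?M = "mat N N (\<lambda>(i, k). (- 1) ^ (N - 1 - k) * esp (N - 1 - k) ({..<N} - {i}))"
  let ?H = "mat N N (\<lambda>(k, j). if N - 1 - k \<le> l j then hsym (l j - (N - 1 - k)) else 0)"
  let ?HN = "map_mat (\<lambda>f. in_N_vars f N) ?H"
  have "mat N N (\<lambda>(i, j). pvar i ^ l j) = ?M * ?HN"
  proof (rule eq_matI)
    fix i j assume "i < dim_row (?M * ?HN)" "j < dim_col (?M * ?HN)"
    then have ij: "i < N" "j < N" by simp_all
    let ?t = "\<lambda>k. if k \<le> l j then (- 1) ^ k * esp k ({..<N} - {i}) * in_N_vars (hsym (l j - k)) N else 0"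
    have "pvar i ^ l j = (\<Sum>k=0..l j. ?t k)"
      unfolding pvar_power_eq[OF ij(1)] by (intro sum.cong) auto
    also have "\<dots> = (\<Sum>k<N. ?t k)"
    proof (rule sum.mono_neutral_cong)
      show "?t k = 0" if "k \<in> {0..l j} - {..<N}" for k
      proof -
        have "card ({..<N} - {i}) < k" using that ij(1) by auto
        then show ?thesis by (simp add: esp_eq_0)
      qed
    qed auto
    also have "\<dots> = (\<Sum>k<N. ?t (N - 1 - k))"
      by (subst sum.nat_diff_reindex[symmetric]) (simp cong: if_cong)
    also have "\<dots> = (?M * ?HN) $$ (i, j)"
      using ij by (auto simp: scalar_prod_def lessThan_atLeast0 intro!: sum.cong)
    finally show "mat N N (\<lambda>(i, j). pvar i ^ l j) $$ (i, j) = (?M * ?HN) $$ (i, j)"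
      using ij by simp
  qed simp_all
  then have "alt N l = det ?M * det ?HN"
    by (simp add: alt_def det_mult[of _ N])
  also have "det ?HN = in_N_vars (jt_det N l) N"
    unfolding jt_det_def by (rule comm_ring_hom.hom_det[OF comm_ring_hom_in_N_vars])
  finally show "alt N l = det ?M * in_N_vars (jt_det N l) N" .
qed

lemma jt_det_delta: "jt_det N (\<lambda>j. N - 1 - j) = 1"
proof -
  let ?H = "mat N N (\<lambda>(k, j). if N - 1 - k \<le> N - 1 - j then hsym (N - 1 - j - (N - 1 - k)) else 0)"
  have "det ?H = prod_list (diag_mat ?H)"
    by (rule det_lower_triangular[of N]) auto
  also have "diag_mat ?H = map (\<lambda>_. 1) [0..<N]"
    by (auto simp: diag_mat_def)
  also have "prod_list (map (\<lambda>_. 1) [0..<N]) = (1 :: symfun)"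
    by (induction N) auto
  finally show ?thesis by (simp only: jt_det_def)
qed

lemma in_N_vars_jt_det: "in_N_vars (jt_det N l) N * vdm N = alt N l"
proof -
  obtain c where c: "\<And>l. alt N l = c * in_N_vars (jt_det N l) N"
    using alt_eq_jt_det by blast
  have "vdm N = c"
    using c[of "\<lambda>j. N - 1 - j"] by (simp only: vdm_def jt_det_delta in_N_vars_1 mult_1_right)
  then show ?thesis using c[of l] by (simp add: mult.commute)
qed

text \<open>
  A further empty row adds the last unit vector as a last column.
\<close>

lemma jt_det_Suc:
  assumes "young_diagram \<nu>" "num_parts \<nu> \<le> N"
  shows "jt_det (Suc N) (dexp (Suc N) \<nu>) = jt_det N (dexp N \<nu>)"
proof -
  let ?A = "\<lambda>N. mat N N (\<lambda>(k, j). if N - 1 - k \<le> dexp N \<nu> j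
    then hsym (dexp N \<nu> j - (N - 1 - k)) else 0)"
  let ?B = "?A (Suc N)"
  have 0: "dexp (Suc N) \<nu> N = 0"
    using part_eq_0_iff[OF assms(1), of N] assms(2) by (simp add: dexp_def)
  have "det ?B = (\<Sum>k<Suc N. ?B $$ (k, N) * cofactor ?B k N)"
    by (rule laplace_expansion_column) auto
  also have "\<dots> = (\<Sum>k<Suc N. if k = N then cofactor ?B N N else 0)"
    by (rule sum.cong[OF refl]) (auto simp: 0)
  also have "\<dots> = det (mat_delete ?B N N)"
    by (simp add: cofactor_def)
  also have "mat_delete ?B N N = ?A N"
  proof (rule eq_matI)
    fix k j assume "k < dim_row (?A N)" "j < dim_col (?A N)"
    then have kj: "k < N" "j < N" by simp_all
    then have "dexp (Suc N) \<nu> j = Suc (dexp N \<nu> j)" "Suc N - 1 - k = Suc (N - 1 - k)"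
      by (auto simp: dexp_def)
    then show "mat_delete ?B N N $$ (k, j) = ?A N $$ (k, j)"
      using kj by (simp add: mat_delete_def)
  qed (simp_all add: mat_delete_def)
  finally show ?thesis by (simp only: jt_det_def)
qed

lemma schur_unique_exists:
  assumes "young_diagram \<nu>"
  shows "\<exists>!s. \<forall>N \<ge> num_parts \<nu>. in_N_vars s N * alternant N {} = alternant N \<nu>"
proof (rule ex_ex1I)
  let ?s = "jt_det (num_parts \<nu>) (dexp (num_parts \<nu>) \<nu>)"
  have "jt_det N (dexp N \<nu>) = ?s" if "num_parts \<nu> \<le> N" for N
    using that by (induction rule: dec_induct) (simp_all add: jt_det_Suc[OF assms])
  then have "\<forall>N \<ge> num_parts \<nu>. in_N_vars ?s N * alternant N {} = alternant N \<nu>"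
    by (metis alternant_empty alternant_eq_alt_dexp in_N_vars_jt_det)
  then show "\<exists>s. \<forall>N \<ge> num_parts \<nu>. in_N_vars s N * alternant N {} = alternant N \<nu>" by blast
next
  fix s s'
  assume s: "\<forall>N \<ge> num_parts \<nu>. in_N_vars s N * alternant N {} = alternant N \<nu>"
    and s': "\<forall>N \<ge> num_parts \<nu>. in_N_vars s' N * alternant N {} = alternant N \<nu>"
  show "s = s'"
  proof (rule symfun_eq_eventuallyI)
    fix N assume "num_parts \<nu> \<le> N"
    then have "in_N_vars s N * vdm N = in_N_vars s' N * vdm N"
      using s s' by (simp add: alternant_empty)
    then show "in_N_vars s N = in_N_vars s' N"
      using vdm_nonzero[of N] by simp
  qed
qed

lemma schur_times_vdm:
  assumes "young_diagram \<nu>" "num_parts \<nu> \<le> N"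
  shows "in_N_vars (schur \<nu>) N * vdm N = alt N (dexp N \<nu>)"
proof -
  note theI'[OF schur_unique_exists[OF assms(1)], folded schur_def, rule_format, OF assms(2)]
  then show ?thesis by (simp only: alternant_empty) (simp only: alternant_eq_alt_dexp)
qed

section \<open>The Schur basis\<close>

text \<open>A permutation of the variables multiplies the polynomial by its sign.\<close>

definition antisymmetric :: "nat \<Rightarrow> cpoly \<Rightarrow> bool" where
  "antisymmetric N g \<longleftrightarrow> in_vars N g \<and>
     (\<forall>\<sigma>. \<sigma> permutes {..<N} \<longrightarrow>
        (\<forall>m. lookup g (Poly_Mapping.map_key \<sigma> m) = of_int (sign \<sigma>) * lookup g m))"

lemma ex_sorting_permutation:
  fixes m :: "nat \<Rightarrow> nat"
  assumes inj: "inj_on m {..<N}"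
  obtains \<sigma> where "\<sigma> permutes {..<N}" "strict_dec N (m \<circ> \<sigma>)"
proof -
  let ?S = "m ` {..<N}"
  define xs where "xs = rev (sorted_list_of_set ?S)"
  have len: "length xs = N" using inj by (simp add: xs_def card_image)
  have set: "set xs = ?S" by (simp add: xs_def)
  have dist: "distinct xs" by (simp add: xs_def)
  have dec: "xs ! j < xs ! i" if "i < j" "j < N" for i j
  proof -
    have "sorted_wrt (<) (sorted_list_of_set ?S)" by simp
    then have "sorted_wrt (>) xs" by (simp add: xs_def sorted_wrt_rev)
    then show ?thesis using that len by (simp add: sorted_wrt_iff_nth_less)
  qed
  define \<sigma> where "\<sigma> i = (if i < N then inv_into {..<N} m (xs ! i) else i)" for i
  have "bij_betw (inv_into {..<N} m \<circ> (!) xs) {..<N} {..<N}"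
  proof (rule bij_betw_trans)
    show "bij_betw ((!) xs) {..<N} ?S" using dist by (intro bij_betw_nth) (simp_all add: len set)
    show "bij_betw (inv_into {..<N} m) ?S {..<N}"
      using inj by (intro bij_betw_inv_into inj_on_imp_bij_betw)
  qed
  then have "bij_betw \<sigma> {..<N} {..<N}"
    by (rule bij_betw_cong[THEN iffD1, rotated]) (simp add: \<sigma>_def)
  then have "\<sigma> permutes {..<N}"
    by (rule bij_imp_permutes) (simp add: \<sigma>_def)
  moreover have "m (\<sigma> i) = xs ! i" if "i < N" for i
  proof -
    have "xs ! i \<in> ?S" using that len set nth_mem by blast
    then show ?thesis using that by (simp add: \<sigma>_def f_inv_into_f)
  qed
  then have "strict_dec N (m \<circ> \<sigma>)"
    using dec by (simp add: strict_dec_def)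
  ultimately show ?thesis using that by blast
qed

lemma lookup_map_key_permutes:
  "\<sigma> permutes A \<Longrightarrow> lookup (Poly_Mapping.map_key \<sigma> m) i = lookup m (\<sigma> i)"
  by (simp add: map_key.rep_eq permutes_inj)

text \<open>An antisymmetric polynomial is determined by its coefficients at strictly decreasing exponents.\<close>

lemma antisymmetric_eq_0I:
  assumes g: "antisymmetric N g" and 0: "\<And>l. strict_dec N l \<Longrightarrow> lookup g (expo N l) = 0"
  shows "g = 0"
proof (rule poly_mapping_eqI)
  fix m
  have anti: "lookup g (Poly_Mapping.map_key \<sigma> m) = of_int (sign \<sigma>) * lookup g m"
    if "\<sigma> permutes {..<N}" for \<sigma>
    using g that unfolding antisymmetric_def by blast
  have "lookup g m = 0"
  proof (cases "keys m \<subseteq> {..<N}")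
    case False
    then show ?thesis
      using g unfolding antisymmetric_def in_vars_def by (meson in_keys_iff)
  next
    case True
    show ?thesis
    proof (cases "inj_on (lookup m) {..<N}")
      case False
      then obtain i j where ij: "i < N" "j < N" "i \<noteq> j" "lookup m i = lookup m j"
        unfolding inj_on_def by auto
      have \<tau>: "transpose i j permutes {..<N}"
        using ij by (intro permutes_swap_id) auto
      have "Poly_Mapping.map_key (transpose i j) m = m"
        by (rule poly_mapping_eqI)
          (use ij in \<open>auto simp: lookup_map_key_permutes[OF \<tau>] transpose_def\<close>)
      then have "lookup g m = - lookup g m"
        using anti[OF \<tau>] ij by (simp add: sign_swap_id)
      then show ?thesis by simp
    next
      case inj: True
      obtain \<sigma> where \<sigma>: "\<sigma> permutes {..<N}" "strict_dec N (lookup m \<circ> \<sigma>)"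
        using ex_sorting_permutation[OF inj] .
      have "Poly_Mapping.map_key \<sigma> m = expo N (lookup m \<circ> \<sigma>)"
      proof (rule poly_mapping_eqI)
        fix i
        have "lookup m i = 0" if "\<not> i < N" using True that by (auto simp: in_keys_iff)
        then show "lookup (Poly_Mapping.map_key \<sigma> m) i = lookup (expo N (lookup m \<circ> \<sigma>)) i"
          using permutes_not_in[OF \<sigma>(1), of i]
          by (auto simp: lookup_map_key_permutes[OF \<sigma>(1)] lookup_expo)
      qed
      then have "of_int (sign \<sigma>) * lookup g m = 0"
        using anti[OF \<sigma>(1)] 0[OF \<sigma>(2)] by simp
      then show ?thesis by (simp add: sign_def split: if_splits)
    qed
  qed
  then show "lookup g m = lookup 0 m" by simp
qed

lemma antisymmetric_alt: "antisymmetric N (alt N l)"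
  unfolding antisymmetric_def
proof (intro conjI allI impI)
  show "in_vars N (alt N l)"
    unfolding in_vars_def
  proof
    fix m assume "m \<in> keys (alt N l)"
    then have "lookup (alt N l) m \<noteq> 0" by (simp add: in_keys_iff)
    then obtain \<sigma> where "expo N (l \<circ> \<sigma>) = m"
      unfolding lookup_alt by (metis (mono_tags, lifting) sum.neutral when_neq_zero)
    then show "keys m \<subseteq> {..<N}" using keys_expo by blast
  qed
next
  fix \<sigma> m assume \<sigma>: "\<sigma> permutes {..<N}"
  have "expo N (l \<circ> (\<tau> \<circ> \<sigma>)) = Poly_Mapping.map_key \<sigma> m \<longleftrightarrow> expo N (l \<circ> \<tau>) = m"
    if \<tau>: "\<tau> permutes {..<N}" for \<tau>
  proof -
    have "expo N (l \<circ> (\<tau> \<circ> \<sigma>)) = Poly_Mapping.map_key \<sigma> (expo N (l \<circ> \<tau>))"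
    proof (rule poly_mapping_eqI)
      fix i
      show "lookup (expo N (l \<circ> (\<tau> \<circ> \<sigma>))) i = lookup (Poly_Mapping.map_key \<sigma> (expo N (l \<circ> \<tau>))) i"
        using permutes_in_image[OF \<sigma>, of i]
        by (simp add: lookup_map_key_permutes[OF \<sigma>] lookup_expo)
    qed
    then show ?thesis
      using bij_is_inj[OF bij_map_key[OF \<sigma>]] by (simp add: inj_eq)
  qed
  then have "(of_int (sign (\<tau> \<circ> \<sigma>)) when expo N (l \<circ> (\<tau> \<circ> \<sigma>)) = Poly_Mapping.map_key \<sigma> m) =
      of_int (sign \<sigma>) * ((of_int (sign \<tau>) :: complex) when expo N (l \<circ> \<tau>) = m)"
    if "\<tau> permutes {..<N}" for \<tau>
    using that sign_compose[of \<tau> \<sigma>] permutes_imp_permutation[OF finite_lessThan] \<sigma>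
    by (simp add: when_def mult.commute)
  then have eq: "(\<Sum>\<tau> | \<tau> permutes {..<N}.
        of_int (sign (\<tau> \<circ> \<sigma>)) when expo N (l \<circ> (\<tau> \<circ> \<sigma>)) = Poly_Mapping.map_key \<sigma> m) =
      of_int (sign \<sigma>) * lookup (alt N l) m"
    unfolding lookup_alt sum_distrib_left by (intro sum.cong) auto
  show "lookup (alt N l) (Poly_Mapping.map_key \<sigma> m) = of_int (sign \<sigma>) * lookup (alt N l) m"
    unfolding eq[symmetric] unfolding lookup_alt
    by (rule sum_permutations_compose_right[OF \<sigma>])
qed

lemma antisymmetric_diff:
  assumes "antisymmetric N f" "antisymmetric N g"
  shows "antisymmetric N (f - g)"
proof -
  have "keys (f - g) \<subseteq> keys f \<union> keys g" by (auto simp: in_keys_iff lookup_minus)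
  then have "in_vars N (f - g)"
    using assms unfolding antisymmetric_def in_vars_def by blast
  then show ?thesis
    using assms unfolding antisymmetric_def by (simp add: lookup_minus right_diff_distrib)
qed

lemma antisymmetric_times_sym_poly:
  assumes f: "sym_poly N f" and g: "antisymmetric N g"
  shows "antisymmetric N (f * g)"
  unfolding antisymmetric_def
proof (intro conjI allI impI)
  show "in_vars N (f * g)"
    unfolding in_vars_def
  proof
    fix m assume "m \<in> keys (f * g)"
    then obtain a b where ab: "m = a + b" "a \<in> keys f" "b \<in> keys g"
      using keys_mult[of f g] by blast
    then have "keys a \<subseteq> {..<N}" "keys b \<subseteq> {..<N}"
      using f g unfolding sym_poly_def antisymmetric_def in_vars_def by blast+
    then show "keys m \<subseteq> {..<N}"
      unfolding ab(1) keys_add_nat by (rule Un_least)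
  qed
next
  fix \<sigma> and m :: "nat \<Rightarrow>\<^sub>0 nat" assume \<sigma>: "\<sigma> permutes {..<N}"
  let ?h = "Poly_Mapping.map_key \<sigma> :: (nat \<Rightarrow>\<^sub>0 nat) \<Rightarrow> _"
  have bij: "bij ?h" using \<sigma> by (rule bij_map_key)
  have bij2: "bij (map_prod ?h ?h)"
    using bij by (simp add: bij_def prod.inj_map map_prod_surj)
  have fg: "lookup f (?h a) = lookup f a" "lookup g (?h a) = of_int (sign \<sigma>) * lookup g a" for a
    using f g \<sigma> unfolding sym_poly_def antisymmetric_def by blast+
  have eq: "?h m = ?h a + ?h b \<longleftrightarrow> m = a + b" for a b
    using bij permutes_inj[OF \<sigma>] by (simp flip: map_key_plus add: inj_eq bij_is_inj)
  have "lookup (f * g) (?h m) = Sum_any (\<lambda>(a, b). lookup f a * lookup g b when ?h m = a + b)"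
    by (rule lookup_times)
  also have "\<dots> = Sum_any (\<lambda>(a, b). lookup (pconst (of_int (sign \<sigma>)) * f) a * lookup g b when m = a + b)"
    by (rule Sum_any.reindex_cong[OF bij2])
      (auto simp: fun_eq_iff fg eq lookup_pconst_times mult.assoc mult.left_commute)
  also have "\<dots> = lookup (pconst (of_int (sign \<sigma>)) * f * g) m"
    by (rule lookup_times[symmetric])
  finally show "lookup (f * g) (?h m) = of_int (sign \<sigma>) * lookup (f * g) m"
    by (simp add: lookup_pconst_times mult.assoc)
qed

lemma mon_deg_keys_vdm: "m \<in> keys (vdm N) \<Longrightarrow> mon_deg m = vdeg N"
proof -
  assume "m \<in> keys (vdm N)"
  then have "lookup (vdm N) m \<noteq> 0" by (simp add: in_keys_iff)
  then obtain \<sigma> where \<sigma>: "\<sigma> permutes {..<N}" "expo N ((\<lambda>j. N - 1 - j) \<circ> \<sigma>) = m"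
    unfolding vdm_def lookup_alt
    by (metis (mono_tags, lifting) mem_Collect_eq sum.neutral when_neq_zero)
  then show ?thesis
    using sum.permute[OF \<sigma>(1), of "\<lambda>j. N - 1 - j"]
    by (auto simp: vdeg_def mon_deg_expo o_def)
qed

lemma mon_deg_dexp:
  assumes "young_diagram \<nu>" "num_parts \<nu> \<le> N"
  shows "mon_deg (expo N (dexp N \<nu>)) = card \<nu> + vdeg N"
  by (simp only: mon_deg_expo card_young_diagram[OF assms] dexp_def vdeg_def sum.distrib)

text \<open>Schur expansions can be read off from the coefficients of the product with the Vandermonde determinant.\<close>

lemma lookup_schur_sum_times_vdm:
  assumes F: "finite F" "\<And>\<nu>. \<nu> \<in> F \<Longrightarrow> young_diagram \<nu> \<and> num_parts \<nu> \<le> N"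
    and \<kappa>: "young_diagram \<kappa>" "num_parts \<kappa> \<le> N"
  shows "lookup (in_N_vars (\<Sum>\<nu>\<in>F. sym_scale (c \<nu>) (schur \<nu>)) N * vdm N) (expo N (dexp N \<kappa>)) =
    (if \<kappa> \<in> F then c \<kappa> else 0)"
proof -
  have "in_N_vars (\<Sum>\<nu>\<in>F. sym_scale (c \<nu>) (schur \<nu>)) N * vdm N =
      (\<Sum>\<nu>\<in>F. pconst (c \<nu>) * alt N (dexp N \<nu>))"
    unfolding in_N_vars_sum sum_distrib_right
    by (intro sum.cong refl) (simp add: in_N_vars_sym_scale mult.assoc schur_times_vdm F)
  also have "lookup \<dots> (expo N (dexp N \<kappa>)) = (\<Sum>\<nu>\<in>F. if \<nu> = \<kappa> then c \<kappa> else 0)"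
    unfolding lookup_sum lookup_pconst_times
  proof (rule sum.cong[OF refl])
    fix \<nu> assume "\<nu> \<in> F"
    then have "(\<forall>j<N. dexp N \<nu> j = dexp N \<kappa> j) \<longleftrightarrow> \<nu> = \<kappa>"
      using F \<kappa> dexp_inject by blast
    then show "c \<nu> * lookup (alt N (dexp N \<nu>)) (expo N (dexp N \<kappa>)) = (if \<nu> = \<kappa> then c \<kappa> else 0)"
      using F \<kappa> \<open>\<nu> \<in> F\<close> by (simp add: lookup_alt_strict_dec strict_dec_dexp)
  qed
  also have "\<dots> = (if \<kappa> \<in> F then c \<kappa> else 0)"
    using F(1) by simp
  finally show ?thesis .
qed

text \<open>
  The coefficients are those of the product with the Vandermonde determinant; the degree bound leaves
  only diagrams with at most \<open>d\<close> boxes.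
\<close>

lemma schur_expansion_N:
  assumes deg: "\<And>m. m \<in> keys (in_N_vars f N) \<Longrightarrow> mon_deg m \<le> d" and "d \<le> N"
  shows "\<exists>c. in_N_vars f N =
    in_N_vars (\<Sum>\<nu> | young_diagram \<nu> \<and> card \<nu> \<le> d. sym_scale (c \<nu>) (schur \<nu>)) N"
proof -
  let ?F = "{\<nu>. young_diagram \<nu> \<and> card \<nu> \<le> d}"
  have F: "finite ?F" "\<And>\<nu>. \<nu> \<in> ?F \<Longrightarrow> young_diagram \<nu> \<and> num_parts \<nu> \<le> N"
    using finite_young_diagrams num_parts_le_card \<open>d \<le> N\<close> le_trans by (blast, fastforce)
  define c where "c \<nu> = lookup (in_N_vars f N * vdm N) (expo N (dexp N \<nu>))" for \<nu>
  let ?s = "\<Sum>\<nu>\<in>?F. sym_scale (c \<nu>) (schur \<nu>)"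
  have anti: "antisymmetric N (in_N_vars g N * vdm N)" for g
  proof (rule antisymmetric_times_sym_poly)
    show "sym_poly N (in_N_vars g N)" using in_N_vars[of g] unfolding sym_seq_def by blast
    show "antisymmetric N (vdm N)" unfolding vdm_def by (rule antisymmetric_alt)
  qed
  have "in_N_vars f N * vdm N - in_N_vars ?s N * vdm N = 0"
  proof (rule antisymmetric_eq_0I)
    show "antisymmetric N (in_N_vars f N * vdm N - in_N_vars ?s N * vdm N)"
      by (intro antisymmetric_diff anti)
    fix l assume "strict_dec N l"
    then obtain \<kappa> where \<kappa>: "young_diagram \<kappa>" "num_parts \<kappa> \<le> N" "\<forall>j<N. dexp N \<kappa> j = l j"
      by (rule strict_dec_eq_dexp)
    then have l: "expo N l = expo N (dexp N \<kappa>)" by (simp add: expo_eq_iff)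
    have "c \<kappa> = 0" if "\<kappa> \<notin> ?F"
    proof (rule ccontr)
      assume "c \<kappa> \<noteq> 0"
      then have "expo N (dexp N \<kappa>) \<in> keys (in_N_vars f N * vdm N)"
        by (simp add: c_def in_keys_iff)
      then obtain a b where ab: "expo N (dexp N \<kappa>) = a + b" "a \<in> keys (in_N_vars f N)" "b \<in> keys (vdm N)"
        using keys_mult by blast
      have "card \<kappa> + vdeg N = mon_deg a + mon_deg b"
        using mon_deg_dexp[OF \<kappa>(1,2)] by (simp add: ab(1) mon_deg_add)
      then have "card \<kappa> \<le> d"
        using deg[OF ab(2)] mon_deg_keys_vdm[OF ab(3)] by simp
      then show False using \<kappa> that by simp
    qed
    then have "lookup (in_N_vars f N * vdm N) (expo N (dexp N \<kappa>)) = (if \<kappa> \<in> ?F then c \<kappa> else 0)"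
      by (auto simp: c_def[of \<kappa>, symmetric])
    also have "\<dots> = lookup (in_N_vars ?s N * vdm N) (expo N (dexp N \<kappa>))"
      by (rule lookup_schur_sum_times_vdm[OF F \<kappa>(1,2), symmetric])
    finally show "lookup (in_N_vars f N * vdm N - in_N_vars ?s N * vdm N) (expo N l) = 0"
      unfolding lookup_minus l by simp
  qed
  then have "in_N_vars f N * vdm N = in_N_vars ?s N * vdm N" by simp
  then have "in_N_vars f N = in_N_vars ?s N"
    using vdm_nonzero[of N] by simp
  then show ?thesis by blast
qed

lemma schur_expansion:
  obtains d c where "f = (\<Sum>\<nu> | young_diagram \<nu> \<and> card \<nu> \<le> d. sym_scale (c \<nu>) (schur \<nu>))"
proof -
  obtain d where d: "\<And>N m. m \<in> keys (in_N_vars f N) \<Longrightarrow> mon_deg m \<le> d"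
    using in_N_vars[of f] unfolding sym_seq_def by blast
  let ?F = "{\<nu>. young_diagram \<nu> \<and> card \<nu> \<le> d}"
  let ?s = "\<lambda>c. \<Sum>\<nu>\<in>?F. sym_scale (c \<nu>) (schur \<nu>)"
  have F: "finite ?F" "\<And>\<nu>. \<nu> \<in> ?F \<Longrightarrow> young_diagram \<nu> \<and> num_parts \<nu> \<le> d"
    using finite_young_diagrams num_parts_le_card le_trans by (blast, fastforce)
  obtain c where c: "in_N_vars f d = in_N_vars (?s c) d"
    using schur_expansion_N[of f d d] d by blast
  have "f = ?s c"
  proof (rule symfun_eq_eventuallyI)
    fix N assume N: "d \<le> N"
    obtain c' where c': "in_N_vars f N = in_N_vars (?s c') N"
      using schur_expansion_N[of f N d] d N by blast
    \<comment> \<open>The coefficients do not depend on the number of variables, as can be seen in \<open>d\<close> variables.\<close>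
    have eq: "in_N_vars (?s c) d = in_N_vars (?s c') d"
      using in_N_vars_eq_downward[OF c' N] c by simp
    have "c \<kappa> = c' \<kappa>" if "\<kappa> \<in> ?F" for \<kappa>
      using lookup_schur_sum_times_vdm[OF F, of \<kappa> c] lookup_schur_sum_times_vdm[OF F, of \<kappa> c']
        F(2)[OF that] that eq by simp
    then have "?s c = ?s c'" by (intro sum.cong) auto
    with c' show "in_N_vars f N = in_N_vars (?s c) N" by simp
  qed
  then show ?thesis using that by blast
qed

lemma lookup_schur_times_vdm:
  assumes "young_diagram \<nu>" "num_parts \<nu> \<le> N" "young_diagram \<kappa>" "num_parts \<kappa> \<le> N"
  shows "lookup (in_N_vars (schur \<nu>) N * vdm N) (expo N (dexp N \<kappa>)) = (if \<kappa> = \<nu> then 1 else 0)"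
  using lookup_schur_sum_times_vdm[of "{\<nu>}" N \<kappa> "\<lambda>_. 1"] assms by simp

lemma inj_on_schur: "inj_on schur {\<nu>. young_diagram \<nu>}"
proof (rule inj_onI)
  fix \<nu> \<kappa> assume Y: "\<nu> \<in> {\<nu>. young_diagram \<nu>}" "\<kappa> \<in> {\<nu>. young_diagram \<nu>}" and eq: "schur \<nu> = schur \<kappa>"
  define N where "N = max (num_parts \<nu>) (num_parts \<kappa>)"
  have N: "num_parts \<nu> \<le> N" "num_parts \<kappa> \<le> N" by (simp_all add: N_def)
  have "(if \<kappa> = \<nu> then 1 else 0) = (if \<kappa> = \<kappa> then 1 else 0 :: complex)"
    using lookup_schur_times_vdm[of \<nu> N \<kappa>] lookup_schur_times_vdm[of \<kappa> N \<kappa>] Y N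
    unfolding eq by simp
  then show "\<nu> = \<kappa>" by (simp split: if_splits)
qed

lemma independent_schur: "\<not> sym.dependent (schur ` {\<nu>. young_diagram \<nu>})"
  unfolding sym.independent_explicit_module
proof (intro allI impI)
  fix t u v
  assume t: "finite t" "t \<subseteq> schur ` {\<nu>. young_diagram \<nu>}"
    and 0: "(\<Sum>v\<in>t. sym_scale (u v) v) = 0" and v: "v \<in> t"
  obtain F where F: "F \<subseteq> {\<nu>. young_diagram \<nu>}" "t = schur ` F"
    using t(2) by (meson subset_imageE)
  have inj: "inj_on schur F" using inj_on_schur F(1) by (rule inj_on_subset)
  have fin: "finite F" using t(1) F(2) inj finite_image_iff by blast
  obtain \<kappa> where \<kappa>: "\<kappa> \<in> F" "v = schur \<kappa>" using v F(2) by blast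
  obtain N where N: "\<And>\<nu>. \<nu> \<in> F \<Longrightarrow> num_parts \<nu> \<le> N"
    using fin by (meson finite_imageI finite_nat_set_iff_bounded_le imageI)
  have "(\<Sum>\<nu>\<in>F. sym_scale (u (schur \<nu>)) (schur \<nu>)) = 0"
    using 0 unfolding F(2) sum.reindex[OF inj] o_def .
  moreover have Y: "young_diagram \<nu> \<and> num_parts \<nu> \<le> N" if "\<nu> \<in> F" for \<nu>
    using that F(1) N by blast
  ultimately have "(if \<kappa> \<in> F then u (schur \<kappa>) else 0) = 0"
    using lookup_schur_sum_times_vdm[OF fin Y, of \<kappa> "\<lambda>\<nu>. u (schur \<nu>)"] Y[OF \<kappa>(1)] by simp
  then show "u v = 0" using \<kappa> by simp
qed

section \<open>The Laguerre operator on Schur functions\<close>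

text \<open>
  The prescribed value of the Laguerre operator at the Schur function of \<open>\<nu>\<close>.
\<close>

definition laguerre_schur :: "complex \<Rightarrow> complex \<Rightarrow> (nat \<times> nat) set \<Rightarrow> symfun" where
  "laguerre_schur z z' \<nu> = sym_scale (- of_nat (card \<nu>)) (schur \<nu>)
     + (\<Sum>b\<in>corners \<nu>. sym_scale ((z + of_int (content b)) * (z' + of_int (content b)))
          (schur (\<nu> - {b})))"

lemma
  shows linear_laguerre_op: "Vector_Spaces.linear sym_scale sym_scale (laguerre_op z z')"
    and laguerre_op_schur: "young_diagram \<nu> \<Longrightarrow> laguerre_op z z' (schur \<nu>) = laguerre_schur z z' \<nu>"
proof -
  let ?P = "\<lambda>D. Vector_Spaces.linear sym_scale sym_scale D \<and>
     (\<forall>\<nu>. young_diagram \<nu> \<longrightarrow> D (schur \<nu>) = laguerre_schur z z' \<nu>)"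
  have "\<exists>!D. ?P D"
  proof (rule ex_ex1I)
    let ?Y = "{\<nu>. young_diagram \<nu>}"
    obtain D where D: "Vector_Spaces.linear sym_scale sym_scale D"
      "\<forall>x\<in>schur ` ?Y. D x = laguerre_schur z z' (inv_into ?Y schur x)"
      using symp.linear_independent_extend[OF independent_schur,
          where f = "\<lambda>x. laguerre_schur z z' (inv_into ?Y schur x)"] by blast
    then have "?P D"
      by (auto simp: inv_into_f_f[OF inj_on_schur])
    then show "\<exists>D. ?P D" by blast
  next
    fix D D' assume D: "?P D" and D': "?P D'"
    show "D = D'"
    proof
      fix f
      obtain d c where f: "f = (\<Sum>\<nu> | young_diagram \<nu> \<and> card \<nu> \<le> d. sym_scale (c \<nu>) (schur \<nu>))"
        by (rule schur_expansion)
      have "D'' f = (\<Sum>\<nu> | young_diagram \<nu> \<and> card \<nu> \<le> d. sym_scale (c \<nu>) (laguerre_schur z z' \<nu>))"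
        if "?P D''" for D''
      proof -
        have lin: "Vector_Spaces.linear sym_scale sym_scale D''" using that by blast
        show ?thesis
          unfolding f symp.linear_sum[OF lin]
          by (intro sum.cong refl) (use that in \<open>simp add: symp.linear_scale[OF lin]\<close>)
      qed
      from this[OF D] this[OF D'] show "D f = D' f" by simp
    qed
  qed
  from theI'[OF this] have "?P (laguerre_op z z')"
    unfolding laguerre_op_def laguerre_schur_def .
  then show "Vector_Spaces.linear sym_scale sym_scale (laguerre_op z z')"
    "young_diagram \<nu> \<Longrightarrow> laguerre_op z z' (schur \<nu>) = laguerre_schur z z' \<nu>" by blast+
qed

lemma laguerre_op_schur_sum:
  assumes "\<And>\<nu>. \<nu> \<in> F \<Longrightarrow> young_diagram \<nu>"
  shows "laguerre_op z z' (\<Sum>\<nu>\<in>F. sym_scale (c \<nu>) (schur \<nu>)) =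
    (\<Sum>\<nu>\<in>F. sym_scale (c \<nu>) (laguerre_schur z z' \<nu>))"
  unfolding symp.linear_sum[OF linear_laguerre_op]
  by (intro sum.cong refl)
    (simp add: symp.linear_scale[OF linear_laguerre_op] laguerre_op_schur assms)

lemma corners_eq:
  assumes Y: "young_diagram \<nu>"
  shows "corners \<nu> = (\<lambda>i. (i, part \<nu> i - 1)) ` {i. part \<nu> (Suc i) < part \<nu> i}"
proof (intro equalityI subsetI)
  note iff = young_diagram_iff_part[OF Y]
  fix b assume b: "b \<in> corners \<nu>"
  obtain i j where ij: "b = (i, j)" by force
  have Y': "young_diagram (\<nu> - {(i, j)})" and "(i, j) \<in> \<nu>"
    using b by (auto simp: corners_def ij)
  then have j: "j < part \<nu> i" using iff by simp
  have notin: "(i', j') \<notin> \<nu> - {(i, j)}" if "i \<le> i'" "j \<le> j'" for i' j'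
    using Y' that unfolding young_diagram_def by blast
  have "\<not> Suc j < part \<nu> i" using notin[of i "Suc j"] iff[of i "Suc j"] by auto
  moreover have "\<not> j < part \<nu> (Suc i)" using notin[of "Suc i" j] iff[of "Suc i" j] by auto
  ultimately show "b \<in> (\<lambda>i. (i, part \<nu> i - 1)) ` {i. part \<nu> (Suc i) < part \<nu> i}"
    using j ij by (intro image_eqI[of _ _ i]) auto
next
  note iff = young_diagram_iff_part[OF Y]
  fix b assume "b \<in> (\<lambda>i. (i, part \<nu> i - 1)) ` {i. part \<nu> (Suc i) < part \<nu> i}"
  then obtain i where i: "part \<nu> (Suc i) < part \<nu> i" and b: "b = (i, part \<nu> i - 1)" by blast
  have "young_diagram (\<nu> - {b})"
    unfolding young_diagram_def
  proof (intro conjI allI impI)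
    show "finite (\<nu> - {b})" using Y by (simp add: young_diagram_def)
    fix a c a' c' assume ac: "(a, c) \<in> \<nu> - {b}" and le: "a' \<le> a" "c' \<le> c"
    have c: "c < part \<nu> a" using ac iff by simp
    have "(a', c') \<in> \<nu>" using Y ac le unfolding young_diagram_def by blast
    moreover have "(a', c') \<noteq> b"
    proof
      assume eq: "(a', c') = b"
      then have "i \<le> a" "part \<nu> i - 1 \<le> c" using le b by auto
      moreover have "\<not> Suc i \<le> a"
      proof
        assume "Suc i \<le> a"
        then have "part \<nu> a \<le> part \<nu> (Suc i)" by (rule part_antimono[OF Y])
        with c i \<open>part \<nu> i - 1 \<le> c\<close> show False by linarith
      qed
      ultimately have "a = i" by linarith
      with c \<open>part \<nu> i - 1 \<le> c\<close> have "c = part \<nu> i - 1" by simp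
      with \<open>a = i\<close> show False using ac b by simp
    qed
    ultimately show "(a', c') \<in> \<nu> - {b}" by simp
  qed
  moreover have "b \<in> \<nu>" using iff[of i "part \<nu> i - 1"] i b by simp
  ultimately show "b \<in> corners \<nu>" by (simp add: corners_def)
qed

lemma part_remove_corner:
  assumes Y: "young_diagram \<nu>" and i: "part \<nu> (Suc i) < part \<nu> i"
  shows "part (\<nu> - {(i, part \<nu> i - 1)}) j = (if j = i then part \<nu> i - 1 else part \<nu> j)"
proof -
  have "{c. (j, c) \<in> \<nu> - {(i, part \<nu> i - 1)}} = {..<(if j = i then part \<nu> i - 1 else part \<nu> j)}"
    using young_diagram_iff_part[OF Y] i by auto
  then show ?thesis by (simp add: part_def)
qed

lemma num_parts_remove: "finite \<nu> \<Longrightarrow> num_parts (\<nu> - {b}) \<le> num_parts \<nu>"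
  unfolding num_parts_def by (intro card_mono) auto

text \<open>
  For \<open>z = N\<close> the factor \<open>z + c\<close> at the last box of a row is the exponent belonging to this row.  The
  rows without a corner contribute alternants with two equal columns or, for an empty last row, the
  factor 0.
\<close>

lemma laguerre_schur_N_vars:
  assumes Y: "young_diagram \<nu>" and N: "num_parts \<nu> \<le> N"
  shows "in_N_vars (laguerre_schur (of_nat N) (of_nat N + b) \<nu>) N * vdm N =
    lag N b (in_N_vars (schur \<nu>) N * vdm N) + of_nat (vdeg N) * (in_N_vars (schur \<nu>) N * vdm N)"
proof -
  let ?l = "dexp N \<nu>" and ?C = "{i. part \<nu> (Suc i) < part \<nu> i}"
  let ?t = "\<lambda>j. pconst (of_nat (?l j) * (of_nat (?l j) + b)) * alt N (?l(j := ?l j - 1))"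
  have C: "?C \<subseteq> {..<N}"
  proof
    fix i assume "i \<in> ?C"
    then have "part \<nu> i \<noteq> 0" by simp
    then show "i \<in> {..<N}" using part_eq_0_iff[OF Y, of i] N by simp
  qed
  have zero: "?t j = 0" if j: "j \<in> {..<N} - ?C" for j
  proof (rule lowered_alt_eq_0)
    show "j < N" using j by simp
    have eq: "part \<nu> (Suc j) = part \<nu> j"
      using j part_antimono[OF Y, of j "Suc j"] by auto
    show "?l j = 0 \<or> (Suc j < N \<and> ?l j = Suc (?l (Suc j)))"
    proof (cases "Suc j < N")
      case True
      then show ?thesis using eq by (simp add: dexp_def)
    next
      case False
      then show ?thesis using j eq part_eq_0_iff[OF Y, of "Suc j"] N by (simp add: dexp_def)
    qed
  qed
  have corner: "pconst ((of_nat N + of_int (content (i, part \<nu> i - 1))) *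
        (of_nat N + b + of_int (content (i, part \<nu> i - 1)))) *
      (in_N_vars (schur (\<nu> - {(i, part \<nu> i - 1)})) N * vdm N) = ?t i" if i: "i \<in> ?C" for i
  proof -
    let ?\<mu> = "\<nu> - {(i, part \<nu> i - 1)}"
    have "(i, part \<nu> i - 1) \<in> corners \<nu>" using i corners_eq[OF Y] by blast
    then have Y': "young_diagram ?\<mu>" by (simp add: corners_def)
    have N': "num_parts ?\<mu> \<le> N"
      using num_parts_remove[of \<nu>] Y N by (metis le_trans young_diagram_def)
    have "i < N" using C i by blast
    then have z: "of_nat N + of_int (content (i, part \<nu> i - 1)) = (of_nat (?l i) :: complex)"
      using i by (simp add: content_def dexp_def of_nat_diff)
    have z': "of_nat N + b + of_int (content (i, part \<nu> i - 1)) = of_nat (?l i) + b"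
      using z by (simp add: algebra_simps)
    have "alt N (dexp N ?\<mu>) = alt N (?l(i := ?l i - 1))"
    proof (rule alt_cong)
      fix j assume "j < N"
      have "part ?\<mu> j = (if j = i then part \<nu> i - 1 else part \<nu> j)"
        using i by (intro part_remove_corner[OF Y]) simp
      then show "dexp N ?\<mu> j = (?l(i := ?l i - 1)) j"
        using i by (auto simp: dexp_def)
    qed
    then show ?thesis
      by (simp only: schur_times_vdm[OF Y' N'] z z')
  qed
  have inj: "inj_on (\<lambda>i. (i, part \<nu> i - 1)) ?C" by (rule inj_onI) simp
  have "in_N_vars (laguerre_schur (of_nat N) (of_nat N + b) \<nu>) N * vdm N =
      - of_nat (card \<nu>) * alt N ?l + (\<Sum>i\<in>?C. ?t i)"
    unfolding laguerre_schur_def corners_eq[OF Y] sum.reindex[OF inj] o_def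
      in_N_vars_add in_N_vars_sum in_N_vars_sym_scale distrib_right[where 'a = cpoly] sum_distrib_right mult.assoc[where 'a = cpoly]
      schur_times_vdm[OF Y N] pconst_uminus pconst_of_nat
    by (intro arg_cong2[of _ _ _ _ plus] refl sum.cong corner)
  also have "(\<Sum>i\<in>?C. ?t i) = (\<Sum>j<N. ?t j)"
    using C zero by (intro sum.mono_neutral_left) auto
  also have "(\<Sum>j<N. ?l j) = card \<nu> + vdeg N"
    by (simp only: card_young_diagram[OF Y N] dexp_def vdeg_def sum.distrib)
  then have "- of_nat (card \<nu>) * alt N ?l + (\<Sum>j<N. ?t j) =
      lag N b (alt N ?l) + of_nat (vdeg N) * alt N ?l"
    by (simp only: lag_alt) (simp add: algebra_simps)
  finally show ?thesis
    by (simp only: schur_times_vdm[OF Y N])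
qed

lemma laguerre_op_N_vars:
  assumes F: "\<forall>\<nu>\<in>F. young_diagram \<nu> \<and> num_parts \<nu> \<le> N"
    and f: "f = (\<Sum>\<nu>\<in>F. sym_scale (c \<nu>) (schur \<nu>))"
  shows "in_N_vars (laguerre_op (of_nat N) (of_nat N + b) f) N * vdm N =
    lag N b (in_N_vars f N * vdm N) + of_nat (vdeg N) * (in_N_vars f N * vdm N)"
proof -
  have fN: "in_N_vars f N * vdm N = (\<Sum>\<nu>\<in>F. pconst (c \<nu>) * (in_N_vars (schur \<nu>) N * vdm N))"
    by (simp add: f in_N_vars_sum in_N_vars_sym_scale sum_distrib_right mult.assoc)
  have "in_N_vars (laguerre_op (of_nat N) (of_nat N + b) f) N * vdm N =
      (\<Sum>\<nu>\<in>F. pconst (c \<nu>) * (in_N_vars (laguerre_schur (of_nat N) (of_nat N + b) \<nu>) N * vdm N))"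
    using F by (simp add: f laguerre_op_schur_sum in_N_vars_sum in_N_vars_sym_scale
        sum_distrib_right mult.assoc)
  also have "\<dots> = (\<Sum>\<nu>\<in>F. pconst (c \<nu>) * (lag N b (in_N_vars (schur \<nu>) N * vdm N) +
      of_nat (vdeg N) * (in_N_vars (schur \<nu>) N * vdm N)))"
    by (rule sum.cong[OF refl]) (simp add: laguerre_schur_N_vars F)
  also have "\<dots> = lag N b (in_N_vars f N * vdm N) + of_nat (vdeg N) * (in_N_vars f N * vdm N)"
    unfolding fN lag_sum lag_pconst sum_distrib_left sum.distrib[symmetric]
    by (intro sum.cong refl) (simp only: distrib_left mult.left_commute)
  finally show ?thesis .
qed

text \<open>
  Only the dependence on \<open>z\<close> matters: it is \<open>z\<close>, and not \<open>z'\<close>, which is tied to the number of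
  variables.
\<close>

lemma laguerre_op_affine:
  "\<exists>X Y. \<forall>z. laguerre_op z z' f = X + sym_scale z Y"
proof -
  obtain d c where f: "f = (\<Sum>\<nu> | young_diagram \<nu> \<and> card \<nu> \<le> d. sym_scale (c \<nu>) (schur \<nu>))"
    by (rule schur_expansion)
  let ?F = "{\<nu>. young_diagram \<nu> \<and> card \<nu> \<le> d}"
  define Y where "Y \<nu> = (\<Sum>b\<in>corners \<nu>. sym_scale (z' + of_int (content b)) (schur (\<nu> - {b})))" for \<nu>
  have schur: "laguerre_schur z z' \<nu> = laguerre_schur 0 z' \<nu> + sym_scale z (Y \<nu>)" for z \<nu>
  proof -
    have "sym_scale ((z + c) * (z' + c)) g = sym_scale ((0 + c) * (z' + c)) g + sym_scale z (sym_scale (z' + c) g)"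
      for c g
      by (simp only: sym.scale_scale sym.scale_left_distrib[symmetric] distrib_right[symmetric] add_0_left add.commute)
    then show ?thesis
      unfolding laguerre_schur_def Y_def sym.scale_sum_right add.assoc sum.distrib[symmetric]
      by (intro arg_cong2[of _ _ _ _ plus] refl sum.cong)
  qed
  have "laguerre_op z z' f = (\<Sum>\<nu>\<in>?F. sym_scale (c \<nu>) (laguerre_schur 0 z' \<nu>)) +
      sym_scale z (\<Sum>\<nu>\<in>?F. sym_scale (c \<nu>) (Y \<nu>))" for z
  proof -
    have "laguerre_op z z' f = (\<Sum>\<nu>\<in>?F. sym_scale (c \<nu>) (laguerre_schur z z' \<nu>))"
      unfolding f by (rule laguerre_op_schur_sum) simp
    also have "\<dots> = (\<Sum>\<nu>\<in>?F. sym_scale (c \<nu>) (laguerre_schur 0 z' \<nu>)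
        + sym_scale z (sym_scale (c \<nu>) (Y \<nu>)))"
      unfolding schur[of z] by (simp only: sym.scale_right_distrib sym.scale_scale mult.commute)
    finally show ?thesis by (simp only: sum.distrib sym.scale_sum_right)
  qed
  then show ?thesis by blast
qed

text \<open>
  The value \<open>N\<close> is also the number of variables, but an identity in \<open>N\<close> variables restricts to fewer
  variables; in \<open>M\<close> variables two values of \<open>N\<close> suffice.
\<close>

lemma affine_eq_0I:
  assumes "\<And>N. N \<ge> d \<Longrightarrow> in_N_vars (X + sym_scale (of_nat N) Y) N = 0"
  shows "X = 0" "Y = 0"
proof -
  have eq: "in_N_vars X M + of_nat N * in_N_vars Y M = 0" if "M \<le> N" "d \<le> N" for M N
    using in_N_vars_0_downward[OF assms[OF that(2)] that(1)]
    by (simp add: in_N_vars_add in_N_vars_sym_scale)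
  have Y: "in_N_vars Y M = 0" for M
  proof -
    have "M \<le> Suc (max M d)" "d \<le> Suc (max M d)" by auto
    note eq_Suc = eq[OF this]
    have "in_N_vars Y M = (in_N_vars X M + of_nat (Suc (max M d)) * in_N_vars Y M)
        - (in_N_vars X M + of_nat (max M d) * in_N_vars Y M)"
      by (simp add: distrib_right)
    also have "\<dots> = 0" using eq_Suc eq[of M "max M d"] by simp
    finally show ?thesis .
  qed
  then show "Y = 0" by (intro symfun_eqI) simp
  show "X = 0" using eq[of _ "max _ d"] Y by (intro symfun_eqI) (metis add.right_neutral in_N_vars_0 max.cobounded1 max.cobounded2 mult_zero_right)
qed

section \<open>The differential operator in the elementary symmetric functions\<close>

text \<open>
  The coefficient of the second derivative with respect to \<open>e\<^sub>m\<close> and \<open>e\<^sub>n\<close>, for \<open>m \<ge> n \<ge> 1\<close>;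
  it is counted twice if \<open>m > n\<close>.
\<close>

definition second_coeff :: "nat \<Rightarrow> nat \<Rightarrow> cpoly" where
  "second_coeff m n = (\<Sum>k=0..n - 1. of_nat (m + n - 1 - 2 * k) * evar (m + n - 1 - k) * evar k)"

text \<open>
  The coefficient of the derivative with respect to \<open>e\<^sub>n\<close>, for \<open>n \<ge> 1\<close>.
\<close>

definition first_coeff :: "complex \<Rightarrow> complex \<Rightarrow> nat \<Rightarrow> cpoly" where
  "first_coeff z z' n = - (of_nat n * evar n)
     + pconst ((z - of_nat n + 1) * (z' - of_nat n + 1)) * evar (n - 1)"

text \<open>
  The differential operator of the theorem.
\<close>

definition laguerre_diff_op :: "complex \<Rightarrow> complex \<Rightarrow> cpoly \<Rightarrow> cpoly" where
  "laguerre_diff_op z z' p =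
     Sum_any (\<lambda>n. second_coeff n n * ederiv n (ederiv n p) when n \<ge> 1)
     + 2 * Sum_any (\<lambda>(m, n). second_coeff m n * ederiv m (ederiv n p) when m > n \<and> n \<ge> 1)
     + Sum_any (\<lambda>n. first_coeff z z' n * ederiv n p when n \<ge> 1)"

lemma Sum_any_shift:
  fixes g :: "nat \<Rightarrow> 'a::comm_monoid_add"
  assumes "\<And>k. k \<ge> K \<Longrightarrow> g (Suc k) = 0"
  shows "Sum_any (\<lambda>n. g n when n \<ge> 1) = (\<Sum>k<K. g (Suc k))"
proof -
  have "{n. (g n when n \<ge> 1) \<noteq> 0} \<subseteq> Suc ` {..<K}"
  proof
    fix n assume "n \<in> {n. (g n when n \<ge> 1) \<noteq> 0}"
    then have "g n \<noteq> 0" "n \<ge> 1" by auto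
    then show "n \<in> Suc ` {..<K}" using assms[of "n - 1"] by (intro image_eqI[of _ _ "n - 1"]) (auto simp: not_le[symmetric])
  qed
  then have "Sum_any (\<lambda>n. g n when n \<ge> 1) = (\<Sum>n\<in>Suc ` {..<K}. g n when n \<ge> 1)"
    by (intro Sum_any.expand_superset) auto
  then show ?thesis by (simp add: sum.reindex)
qed

lemma Sum_any_shift_pairs:
  fixes g :: "nat \<Rightarrow> nat \<Rightarrow> 'a::comm_monoid_add"
  assumes "\<And>m n. m \<ge> K \<Longrightarrow> g (Suc m) (Suc n) = 0"
  shows "Sum_any (\<lambda>(m, n). g m n when m > n \<and> n \<ge> 1) = (\<Sum>m<K. \<Sum>n<m. g (Suc m) (Suc n))"
proof -
  let ?A = "SIGMA m:{..<K}. {..<m}"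
  have "{x. (case x of (m, n) \<Rightarrow> g m n when m > n \<and> n \<ge> 1) \<noteq> 0} \<subseteq> map_prod Suc Suc ` ?A"
  proof
    fix x assume x: "x \<in> {x. (case x of (m, n) \<Rightarrow> g m n when m > n \<and> n \<ge> 1) \<noteq> 0}"
    obtain m n where mn: "x = (m, n)" by force
    have g: "g m n \<noteq> 0" "n < m" "1 \<le> n" using x mn by auto
    then have "m - 1 < K" using assms[of "m - 1" "n - 1"] by (cases "m - 1 < K") auto
    then show "x \<in> map_prod Suc Suc ` ?A"
      using g mn by (intro image_eqI[of _ _ "(m - 1, n - 1)"]) auto
  qed
  then have "Sum_any (\<lambda>(m, n). g m n when m > n \<and> n \<ge> 1) =
      (\<Sum>(m, n)\<in>map_prod Suc Suc ` ?A. g m n when m > n \<and> n \<ge> 1)"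
    by (intro Sum_any.expand_superset) auto
  also have "\<dots> = (\<Sum>(m, n)\<in>?A. g (Suc m) (Suc n))"
    by (subst sum.reindex) (auto simp: inj_on_def intro!: sum.cong)
  also have "\<dots> = (\<Sum>m<K. \<Sum>n<m. g (Suc m) (Suc n))"
    by (rule sum.Sigma[symmetric]) auto
  finally show ?thesis .
qed

lemma sum_square_symmetric:
  fixes f :: "nat \<Rightarrow> nat \<Rightarrow> 'a::comm_ring_1"
  assumes "\<And>m n. f m n = f n m"
  shows "(\<Sum>m<K. \<Sum>n<K. f m n) = (\<Sum>m<K. f m m) + 2 * (\<Sum>m<K. \<Sum>n<m. f m n)"
proof (induction K)
  case (Suc K)
  have "(\<Sum>m<K. f m K) = (\<Sum>n<K. f K n)" by (intro sum.cong refl assms)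
  with Suc show ?case by (simp add: sum.distrib algebra_simps)
qed simp

lemma laguerre_diff_op_finite:
  assumes K: "\<forall>k\<ge>K. pderiv_var k p = 0"
  shows "laguerre_diff_op z z' p =
    (\<Sum>k<K. second_coeff (Suc k) (Suc k) * pderiv_var k (pderiv_var k p))
    + 2 * (\<Sum>m<K. \<Sum>n<m. second_coeff (Suc m) (Suc n) * pderiv_var m (pderiv_var n p))
    + (\<Sum>k<K. first_coeff z z' (Suc k) * pderiv_var k p)"
proof -
  have 0: "pderiv_var m (pderiv_var n p) = 0" if "m \<ge> K" for m n
    using K that by (simp add: pderiv_var_commute[of m n])
  have "Sum_any (\<lambda>n. second_coeff n n * ederiv n (ederiv n p) when n \<ge> 1) =
      (\<Sum>k<K. second_coeff (Suc k) (Suc k) * ederiv (Suc k) (ederiv (Suc k) p))"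
    by (rule Sum_any_shift) (simp add: ederiv_def 0)
  moreover have "Sum_any (\<lambda>(m, n). second_coeff m n * ederiv m (ederiv n p) when m > n \<and> n \<ge> 1) =
      (\<Sum>m<K. \<Sum>n<m. second_coeff (Suc m) (Suc n) * ederiv (Suc m) (ederiv (Suc n) p))"
    by (rule Sum_any_shift_pairs) (simp add: ederiv_def 0)
  moreover have "Sum_any (\<lambda>n. first_coeff z z' n * ederiv n p when n \<ge> 1) =
      (\<Sum>k<K. first_coeff z z' (Suc k) * ederiv (Suc k) p)"
    by (rule Sum_any_shift) (simp add: ederiv_def K)
  ultimately show ?thesis
    by (simp only: laguerre_diff_op_def ederiv_def diff_Suc_1)
qed

lemma symbol_commute: "symbol N m n = symbol N n m"
  unfolding symbol_def by (intro sum.cong refl) (simp only: mult_ac)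

lemma symbol_eq_0: "m \<ge> N \<Longrightarrow> symbol N m n = 0"
  unfolding symbol_def
proof (intro sum.neutral ballI)
  fix i assume "m \<ge> N" "i \<in> {..<N}"
  then have "card ({..<N} - {i}) < m" by auto
  then show "pvar i * esp m ({..<N} - {i}) * esp n ({..<N} - {i}) = 0"
    by (simp add: esp_eq_0)
qed

lemma at_esp_second_coeff:
  assumes "n \<le> m"
  shows "at_esp N (second_coeff (Suc m) (Suc n)) = symbol N m n"
proof -
  have "Suc m + Suc n - 1 = m + n + 1" "Suc n - 1 = n" by simp_all
  then show ?thesis
    by (simp only: symbol_def sum_var_esp_esp[OF finite_lessThan assms] second_coeff_def
        at_esp_sum at_esp_mult at_esp_of_nat at_esp_evar)
qed

lemma at_esp_first_coeff:
  "at_esp N (first_coeff (of_nat N) (of_nat N + b) (Suc k)) =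
     pconst ((of_nat N - of_nat k) * (of_nat N - of_nat k + b)) * esp k {..<N}
     - of_nat (Suc k) * esp (Suc k) {..<N}"
proof -
  have "(of_nat N - of_nat (Suc k) + 1) * (of_nat N + b - of_nat (Suc k) + 1) =
      (of_nat N - of_nat k) * (of_nat N - of_nat k + b)" by simp
  then show ?thesis
    unfolding first_coeff_def
    by (simp only: at_esp_add at_esp_uminus at_esp_mult at_esp_of_nat at_esp_evar at_esp_pconst
        diff_Suc_1) simp
qed

lemma at_esp_laguerre_diff_op:
  "at_esp N (laguerre_diff_op (of_nat N) (of_nat N + b) p) =
    (\<Sum>k<N. \<Sum>j<N. symbol N k j * at_esp N (pderiv_var k (pderiv_var j p)))
    + (\<Sum>k<N. (pconst ((of_nat N - of_nat k) * (of_nat N - of_nat k + b)) * esp k {..<N}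
         - of_nat (Suc k) * esp (Suc k) {..<N}) * at_esp N (pderiv_var k p))"
proof -
  obtain K0 where K0: "\<forall>k\<ge>K0. pderiv_var k p = 0"
    using pderiv_var_eventually_0 by blast
  define K where "K = max K0 N"
  have K: "\<forall>k\<ge>K. pderiv_var k p = 0" and "N \<le> K"
    using K0 by (simp_all add: K_def)
  let ?s = "\<lambda>m n. symbol N m n * at_esp N (pderiv_var m (pderiv_var n p))"
  let ?c = "\<lambda>k. pconst ((of_nat N - of_nat k) * (of_nat N - of_nat k + b)) * esp k {..<N}
         - of_nat (Suc k) * esp (Suc k) {..<N}"
  have "at_esp N (laguerre_diff_op (of_nat N) (of_nat N + b) p) =
      (\<Sum>k<K. ?s k k) + 2 * (\<Sum>m<K. \<Sum>n<m. ?s m n) + (\<Sum>k<K. ?c k * at_esp N (pderiv_var k p))"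
  proof -
    have "at_esp N 2 = 2" using at_esp_of_nat[of N 2] by simp
    moreover have "(\<Sum>m<K. \<Sum>n<m. at_esp N (second_coeff (Suc m) (Suc n)) *
        at_esp N (pderiv_var m (pderiv_var n p))) = (\<Sum>m<K. \<Sum>n<m. ?s m n)"
      by (intro sum.cong refl) (simp add: at_esp_second_coeff)
    ultimately show ?thesis
      by (simp only: laguerre_diff_op_finite[OF K] at_esp_add at_esp_sum at_esp_mult
          at_esp_first_coeff at_esp_second_coeff[OF order_refl])
  qed
  also have "(\<Sum>k<K. ?s k k) + 2 * (\<Sum>m<K. \<Sum>n<m. ?s m n) = (\<Sum>m<K. \<Sum>n<K. ?s m n)"
    by (rule sum_square_symmetric[symmetric]) (simp only: symbol_commute pderiv_var_commute)
  also have "\<dots> = (\<Sum>m<N. \<Sum>n<N. ?s m n)"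
  proof (rule sum.mono_neutral_cong_right)
    show "\<forall>m\<in>{..<K} - {..<N}. (\<Sum>n<K. ?s m n) = 0" by (simp add: symbol_eq_0)
    show "(\<Sum>n<K. ?s m n) = (\<Sum>n<N. ?s m n)" for m
      using \<open>N \<le> K\<close> by (intro sum.mono_neutral_right) (auto simp: symbol_commute[of N m] symbol_eq_0)
  qed (use \<open>N \<le> K\<close> in auto)
  also have "(\<Sum>k<K. ?c k * at_esp N (pderiv_var k p)) = (\<Sum>k<N. ?c k * at_esp N (pderiv_var k p))"
  proof (rule sum.mono_neutral_right)
    show "\<forall>k\<in>{..<K} - {..<N}. ?c k * at_esp N (pderiv_var k p) = 0"
    proof
      fix k assume k: "k \<in> {..<K} - {..<N}"
      \<comment> \<open>For \<open>k = N\<close> the coefficient of \<open>e\<^sub>k\<close> contains the factor \<open>z - k = 0\<close>.\<close>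
      then have "k = N \<or> esp k {..<N} = 0" by (auto intro: esp_eq_0)
      moreover have "esp (Suc k) {..<N} = 0" using k by (intro esp_eq_0) auto
      ultimately have "?c k = 0" by auto
      then show "?c k * at_esp N (pderiv_var k p) = 0" by simp
    qed
  qed (use \<open>N \<le> K\<close> in auto)
  finally show ?thesis .
qed

lemma laguerre_diff_op_affine:
  "\<exists>q r. \<forall>z. laguerre_diff_op z z' p = q + pconst z * r"
proof -
  obtain K where K: "\<forall>k\<ge>K. pderiv_var k p = 0"
    using pderiv_var_eventually_0 by blast
  define r where "r = (\<Sum>k<K. pconst (z' - of_nat k) * evar k * pderiv_var k p)"
  have first: "first_coeff z z' (Suc k) = first_coeff 0 z' (Suc k) + pconst z * (pconst (z' - of_nat k) * evar k)"
    for z k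
  proof -
    have "(z - of_nat (Suc k) + 1) * (z' - of_nat (Suc k) + 1) =
        (0 - of_nat (Suc k) + 1) * (z' - of_nat (Suc k) + 1) + z * (z' - of_nat k)"
      by (simp add: algebra_simps)
    then show ?thesis
      unfolding first_coeff_def
      by (simp only: pconst_add pconst_mult distrib_right add.assoc mult.assoc diff_Suc_1)
  qed
  have "laguerre_diff_op z z' p = laguerre_diff_op 0 z' p + pconst z * r" for z
  proof -
    have "(\<Sum>k<K. first_coeff z z' (Suc k) * pderiv_var k p) =
        (\<Sum>k<K. first_coeff 0 z' (Suc k) * pderiv_var k p) + pconst z * r"
      unfolding r_def sum_distrib_left sum.distrib[symmetric]
      by (rule sum.cong[OF refl]) (simp only: first[of z] distrib_right mult.assoc)
    then show ?thesis
      by (simp only: laguerre_diff_op_finite[OF K] add.assoc)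
  qed
  then show ?thesis by blast
qed

lemma laguerre_op_of_epoly: "laguerre_op z z' (of_epoly p) = of_epoly (laguerre_diff_op z z' p)"
proof -
  obtain X Y where XY: "\<And>z. laguerre_op z z' (of_epoly p) = X + sym_scale z Y"
    using laguerre_op_affine[of z' "of_epoly p"] by blast
  obtain q r where qr: "\<And>z. laguerre_diff_op z z' p = q + pconst z * r"
    using laguerre_diff_op_affine[of z' p] by blast
  have diff: "laguerre_op z z' (of_epoly p) - of_epoly (laguerre_diff_op z z' p) =
      (X - of_epoly q) + sym_scale z (Y - of_epoly r)" for z
    unfolding XY qr of_epoly_add of_epoly_mult of_epoly_pconst
    by (simp add: sym_scale_def algebra_simps)
  obtain d c where f: "of_epoly p = (\<Sum>\<nu> | young_diagram \<nu> \<and> card \<nu> \<le> d. sym_scale (c \<nu>) (schur \<nu>))"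
    by (rule schur_expansion)
  have "in_N_vars ((X - of_epoly q) + sym_scale (of_nat N) (Y - of_epoly r)) N = 0" if N: "N \<ge> d" for N
  proof -
    define b where "b = z' - of_nat N"
    have F: "\<forall>\<nu>\<in>{\<nu>. young_diagram \<nu> \<and> card \<nu> \<le> d}. young_diagram \<nu> \<and> num_parts \<nu> \<le> N"
      using N num_parts_le_card le_trans by blast
    have "in_N_vars (laguerre_op (of_nat N) (of_nat N + b) (of_epoly p)) N * vdm N =
        vdm N * at_esp N (laguerre_diff_op (of_nat N) (of_nat N + b) p)"
      unfolding laguerre_op_N_vars[OF F f] at_esp_laguerre_diff_op
      using lag_vdm_times_at_esp[of N b p] by (simp only: at_esp_def[of N p, symmetric] mult.commute[of _ "vdm N"])
    then have "in_N_vars (laguerre_op (of_nat N) z' (of_epoly p)) N =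
        in_N_vars (of_epoly (laguerre_diff_op (of_nat N) z' p)) N"
      using vdm_nonzero[of N] by (simp add: b_def at_esp_def mult.commute)
    then show ?thesis
      by (simp only: diff[symmetric] in_N_vars_minus) simp
  qed
  from affine_eq_0I[OF this] have "laguerre_op z z' (of_epoly p) - of_epoly (laguerre_diff_op z z' p) = 0"
    unfolding diff by simp
  then show ?thesis by simp
qed

theorem theorem4p10:
  fixes z z' :: complex and p :: cpoly
  shows "laguerre_op z z' (of_epoly p) = of_epoly (
      Sum_any (\<lambda>n. (\<Sum>k=0..n - 1. of_nat (2 * n - 1 - 2 * k) * evar (2 * n - 1 - k) * evar k)
                     * ederiv n (ederiv n p) when n \<ge> 1)
    + 2 * Sum_any (\<lambda>(m, n). (\<Sum>k=0..n - 1. of_nat (m + n - 1 - 2 * k) * evar (m + n - 1 - k) * evar k)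
                     * ederiv m (ederiv n p) when m > n \<and> n \<ge> 1)
    + Sum_any (\<lambda>n. (- (of_nat n * evar n)
                     + pconst ((z - of_nat n + 1) * (z' - of_nat n + 1)) * evar (n - 1))
                     * ederiv n p when n \<ge> 1))"
  using laguerre_op_of_epoly[of z z' p]
  unfolding laguerre_diff_op_def second_coeff_def first_coeff_def mult_2[symmetric] .

end
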